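(* Fix a complete geodesic $L\subset Y$ and, for $t\in\mathbb{R}$, let $Y_{L,t}$ be the associated floating plane. Then the Hausdorff distance between $\pi(Y_{L,t})$ and $L$ tends to $0$ as $|t|\to\infty$.
   Context: Let $G=\mathrm{SL}_3(\mathbb{R})$, $K=\mathrm{SO}(3)$, $X=G/K$ with its $G$-invariant Riemannian metric (nonpositively curved), $o=[K]$. Let $F(x,y,z)=2xz-y^2$, let $H$ be the identity component of $\{g\in G:F\circ g=F\}$, and $Y=H\cdot o$, a totally geodesic plane. Let $A_0=\{\mathrm{diag}(e^s,1,e^{-s}):s\in\mathbb{R}\}<H$ and $a_t=\mathrm{diag}(e^t,e^{-2t},e^t)$. Every complete geodesic $L\subset Y$ is $L=hA_0o$ for some $h\in H$, and the floating plane is $Y_{L,t}:=ha_tY$ (independent of the choice of $h$). The map $\pi:X\to Y$ is the nearest point projection: $\pi(x)$ is the unique point $y\in Y$ with $d(x,y)=\inf_{y'\in Y}d(x,y')$. *)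

theory Defs
  imports "HOL-Analysis.Analysis"
begin

section \<open>The symmetric space of SL(3,R)\<close>

definition SL3 :: "(real^3^3) set" where
  "SL3 = {g. det g = 1}"

definition SO3 :: "(real^3^3) set" where
  "SO3 = {k. rotation_matrix k}"

text \<open>Points of the quotient of \<open>SL3\<close> by \<open>SO3\<close> are left cosets, represented as sets of
  matrices; the group acts by left translation of cosets.\<close>

definition act :: "real^3^3 \<Rightarrow> (real^3^3) set \<Rightarrow> (real^3^3) set" where
  "act g x = (\<lambda>a. g ** a) ` x"

definition basept :: "(real^3^3) set" where
  "basept = SO3"

definition spaceX :: "(real^3^3) set set" where
  "spaceX = (\<lambda>g. act g basept) ` SL3"

text \<open>The tangent space of \<open>spaceX\<close> at the base point is the Lie algebra \<open>sl(3)\<close> modulo \<open>so(3)\<close>,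
  identified with the traceless symmetric matrices by taking symmetric parts. The
  \<open>SL3\<close>-invariant Riemannian metrics on \<open>spaceX\<close> correspond to the \<open>Ad(SO3)\<close>-invariant inner products
  on this space (and so \<open>spaceX\<close> has only one up to scaling). Bilinearity is demanded on all matrices
  for convenience only: every inner product on the tangent space extends, and no value outside
  it is used.\<close>

definition tangent_o :: "(real^3^3) set" where
  "tangent_o = {A. transpose A = A \<and> trace A = 0}"

definition sym_part :: "real^3^3 \<Rightarrow> real^3^3" where
  "sym_part A = (1/2) *\<^sub>R (A + transpose A)"

definition invariant_metric :: "(real^3^3 \<Rightarrow> real^3^3 \<Rightarrow> real) \<Rightarrow> bool" where
  "invariant_metric B \<longleftrightarrow>
     bilinear B \<and>
     (\<forall>A\<in>tangent_o. \<forall>C\<in>tangent_o. B A C = B C A) \<and>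
     (\<forall>A\<in>tangent_o. A \<noteq> 0 \<longrightarrow> B A A > 0) \<and>
     (\<forall>k\<in>SO3. \<forall>A\<in>tangent_o. \<forall>C\<in>tangent_o.
        B (k ** A ** matrix_inv k) (k ** C ** matrix_inv k) = B A C)"

text \<open>A \<open>C\<^sup>1\<close> curve in \<open>spaceX\<close> is given by a \<open>C\<^sup>1\<close> lift \<open>c\<close> to \<open>SL3\<close>. By invariance, its speed at
  time \<open>t\<close> is the norm of the class of \<open>c(t)\<^sup>-\<^sup>1 c'(t)\<close> in the tangent space at the base point.
  Curves need not be regular, so corners can be reparametrised away and \<open>C\<^sup>1\<close> curves give the same
  infimum of lengths as piecewise \<open>C\<^sup>1\<close> ones.\<close>

definition speed :: "(real^3^3 \<Rightarrow> real^3^3 \<Rightarrow> real) \<Rightarrow> (real \<Rightarrow> real^3^3) \<Rightarrow> real \<Rightarrow> real" where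
  "speed B c t =
     (let v = sym_part (matrix_inv (c t) ** vector_derivative c (at t)) in sqrt (B v v))"

definition curve_length :: "(real^3^3 \<Rightarrow> real^3^3 \<Rightarrow> real) \<Rightarrow> (real \<Rightarrow> real^3^3) \<Rightarrow> real" where
  "curve_length B c = integral {0..1} (speed B c)"

definition curves :: "(real^3^3) set \<Rightarrow> (real^3^3) set \<Rightarrow> (real \<Rightarrow> real^3^3) set" where
  "curves x y = {c. c C1_differentiable_on {0..1} \<and> c ` {0..1} \<subseteq> SL3 \<and>
                    act (c 0) basept = x \<and> act (c 1) basept = y}"

definition distX ::
  "(real^3^3 \<Rightarrow> real^3^3 \<Rightarrow> real) \<Rightarrow> (real^3^3) set \<Rightarrow> (real^3^3) set \<Rightarrow> real" where
  "distX B x y = (INF c\<in>curves x y. curve_length B c)"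

text \<open>Complete Riemannian geodesics as point sets: images of unit speed, locally distance
  minimising curves defined on the whole line. (As \<open>spaceX\<close> is nonpositively curved and simply
  connected, they are then globally minimising.)\<close>

definition complete_geodesic ::
  "(real^3^3 \<Rightarrow> real^3^3 \<Rightarrow> real) \<Rightarrow> (real^3^3) set set \<Rightarrow> bool" where
  "complete_geodesic B L \<longleftrightarrow>
     (\<exists>\<gamma> :: real \<Rightarrow> (real^3^3) set. range \<gamma> = L \<and> L \<subseteq> spaceX \<and>
        (\<forall>t. \<exists>e>0. \<forall>r\<in>ball t e. \<forall>s\<in>ball t e. distX B (\<gamma> r) (\<gamma> s) = \<bar>r - s\<bar>))"

text \<open>The Hausdorff distance is extended-valued, so that the suprema are always meaningful.\<close>

definition hausdorff_distX ::
  "(real^3^3 \<Rightarrow> real^3^3 \<Rightarrow> real) \<Rightarrow> (real^3^3) set set \<Rightarrow> (real^3^3) set set \<Rightarrow> ennreal" where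
  "hausdorff_distX B S T =
     max (SUP x\<in>S. INF y\<in>T. ennreal (distX B x y)) (SUP y\<in>T. INF x\<in>S. ennreal (distX B x y))"

section \<open>The totally geodesic plane and the floating planes\<close>

definition formF :: "real^3 \<Rightarrow> real" where
  "formF v = 2 * v$1 * v$3 - (v$2)\<^sup>2"

definition groupH :: "(real^3^3) set" where
  "groupH = connected_component_set {g \<in> SL3. formF \<circ> (\<lambda>v. g *v v) = formF} (mat 1)"

definition planeY :: "(real^3^3) set set" where
  "planeY = (\<lambda>h. act h basept) ` groupH"

definition diag3 :: "real \<Rightarrow> real \<Rightarrow> real \<Rightarrow> real^3^3" where
  "diag3 x y z = vector [vector [x, 0, 0], vector [0, y, 0], vector [0, 0, z]]"

definition A0 :: "(real^3^3) set" where
  "A0 = range (\<lambda>s. diag3 (exp s) 1 (exp (- s)))"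

definition a_diag :: "real \<Rightarrow> real^3^3" where
  "a_diag t = diag3 (exp t) (exp (- 2 * t)) (exp t)"

definition projY :: "(real^3^3 \<Rightarrow> real^3^3 \<Rightarrow> real) \<Rightarrow> (real^3^3) set \<Rightarrow> (real^3^3) set" where
  "projY B x = (THE y. y \<in> planeY \<and> distX B x y = (INF y'\<in>planeY. distX B x y'))"

text \<open>Every complete geodesic \<open>L\<close> in \<open>planeY\<close> is of the form \<open>h A0 o\<close> with \<open>h\<close> in \<open>groupH\<close>, and the floating
  plane does not depend on which such \<open>h\<close> is chosen.\<close>

definition floating_plane :: "(real^3^3) set set \<Rightarrow> real \<Rightarrow> (real^3^3) set set" where
  "floating_plane L t =
     (let h = (SOME h. h \<in> groupH \<and> L = (\<lambda>b. act (h ** b) basept) ` A0)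
      in act (h ** a_diag t) ` planeY)"

end

(* The proof replaces comparison geometry by Busemann functions. For orthogonal p, q and weights
   a, b >= 0 the function b ln |g^T p|^2 + a ln |g^-1 q|^2 on SL3/SO3 is Lipschitz with an explicit
   constant, by invariance of the metric and the Cauchy-Schwarz inequality, and it grows at exactly
   this rate along a suitable one-parameter group. This gives the distances in the diagonal flat,
   and the rigidity of its equality case shows that every complete geodesic in the plane Y is
   h A0 o.

   For the projection write Y = {D_s E_r o} in Fermi coordinates along A0 o, where D_s runs through
   A0 and E_r is the translation by r perpendicular to it. As a_t commutes with D_s, one has to
   project a_t E_r o. Choose rho with tanh(2 rho) = tanh(2 r) / cosh(3 t). Then
   E_(-rho) a_t E_r o = m o with m diagonal in the orthogonal basis (1,0,1), (0,1,0), (-1,0,1), that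
   is, m o lies on a geodesic perpendicular to Y at o. The Busemann function of that geodesic shows
   that o is the point of Y nearest to m o. Hence D_s a_t E_r o projects to D_s E_rho o, which is at
   distance at most a constant times artanh(1 / cosh(3 t)) from D_s o, and r = 0 gives D_s o itself. *)

theory Submission
  imports Defs
begin

text \<open>The distance is an infimum over all C1 curves, so each lower bound needs a function that
  no curve can change too fast. Up to a constant factor, the differential of the Busemann function
  at g o is the pairing with b line_form(xi) - a line_form(eta), where xi and eta are the directions
  of g^T p and g^-1 q. These remain orthogonal since <g^T p, g^-1 q> = <p, q>, and then the norm of
  the combination does not depend on them: the Lipschitz constant is global. For a diagonal matrix
  with entries m_i <= m_l <= m_j the weights a = m_j - m_l, b = m_l - m_i make the combination -m,
  which is why the order of the exponents is tracked throughout.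

  The formula for rho is a 2 by 2 computation. On the span of (1,0,1), (0,1,0), a_t acts as diag(X,
  Z) with X / Z = e^(3t), and E_r as a hyperbolic rotation. Orthogonal rows of E_(-rho) a_t E_r mean
  tanh(2 rho) = tanh(2 r) 2XZ / (X^2 + Z^2), and the last factor is 1 / cosh(3t).

  The obstacle is uniqueness of the nearest point: for r = 0 two exponents of m coincide, a weight
  vanishes, and the Busemann function is constant along A0 o.\<close>

declare transpose_matrix_vector [simp del]

section \<open>Three by three matrices and cosets\<close>

text \<open>Explicit entries turn identities between concrete matrices into nine scalar ones,
  through \<open>mat9_simps\<close>.\<close>

definition mat9 :: "real \<Rightarrow> real \<Rightarrow> real \<Rightarrow> real \<Rightarrow> real \<Rightarrow> real \<Rightarrow> real \<Rightarrow> real \<Rightarrow> real \<Rightarrow> real^3^3" where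
  "mat9 a b c d e f g h i = vector [vector [a, b, c], vector [d, e, f], vector [g, h, i]]"

lemma mat9_nth [simp]:
  "mat9 a b c d e f g h i $ 1 = vector [a, b, c]"
  "mat9 a b c d e f g h i $ 2 = vector [d, e, f]"
  "mat9 a b c d e f g h i $ 3 = vector [g, h, i]"
  by (simp_all add: mat9_def)

lemma vec3_eq_iff: "(x::'a^3) = y \<longleftrightarrow> x$1 = y$1 \<and> x$2 = y$2 \<and> x$3 = y$3"
  by (simp add: vec_eq_iff forall_3)

lemma vector3_eq_iff: "(vector [a, b, c] :: real^3) = vector [a', b', c'] \<longleftrightarrow> a = a' \<and> b = b' \<and> c = c'"
  by (simp add: vec3_eq_iff)

lemma mat9_eq_iff:
  "mat9 a b c d e f g h i = mat9 a' b' c' d' e' f' g' h' i' \<longleftrightarrow>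
   a = a' \<and> b = b' \<and> c = c' \<and> d = d' \<and> e = e' \<and> f = f' \<and> g = g' \<and> h = h' \<and> i = i'"
  by (auto simp: vec3_eq_iff)

lemma mat9_eta:
  "(M::real^3^3) = mat9 (M$1$1) (M$1$2) (M$1$3) (M$2$1) (M$2$2) (M$2$3) (M$3$1) (M$3$2) (M$3$3)"
  by (simp add: vec3_eq_iff)

lemma vector3_cases: obtains x y z where "(v::real^3) = vector [x, y, z]"
  using that[of "v$1" "v$2" "v$3"] by (simp add: vec3_eq_iff)

lemma mat9_mult:
  "mat9 a b c d e f g h i ** mat9 a' b' c' d' e' f' g' h' i' =
   mat9 (a*a'+b*d'+c*g') (a*b'+b*e'+c*h') (a*c'+b*f'+c*i')
        (d*a'+e*d'+f*g') (d*b'+e*e'+f*h') (d*c'+e*f'+f*i')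
        (g*a'+h*d'+i*g') (g*b'+h*e'+i*h') (g*c'+h*f'+i*i')"
  by (simp add: vec3_eq_iff matrix_matrix_mult_def sum_3)

lemma mat9_mult_vec:
  "mat9 a b c d e f g h i *v vector [x, y, z] = vector [a*x+b*y+c*z, d*x+e*y+f*z, g*x+h*y+i*z]"
  by (simp add: vec3_eq_iff matrix_vector_mult_def sum_3)

lemma mat9_transpose: "transpose (mat9 a b c d e f g h i) = mat9 a d g b e h c f i"
  by (simp add: vec3_eq_iff transpose_def)

lemma mat9_det: "det (mat9 a b c d e f g h i) = a*e*i + b*f*g + c*d*h - a*f*h - b*d*i - c*e*g"
  by (simp add: det_3)

lemma mat9_one: "mat 1 = mat9 1 0 0 0 1 0 0 0 1"
  by (simp add: vec3_eq_iff mat_def)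

lemma mat9_trace: "trace (mat9 a b c d e f g h i) = a + e + i"
  by (simp add: trace_def sum_3)

lemma mat9_add:
  "mat9 a b c d e f g h i + mat9 a' b' c' d' e' f' g' h' i' =
   mat9 (a+a') (b+b') (c+c') (d+d') (e+e') (f+f') (g+g') (h+h') (i+i')"
  by (simp add: vec3_eq_iff)

lemma mat9_scaleR: "k *\<^sub>R mat9 a b c d e f g h i = mat9 (k*a) (k*b) (k*c) (k*d) (k*e) (k*f) (k*g) (k*h) (k*i)"
  by (simp add: vec3_eq_iff)

lemma mat9_diff:
  "mat9 a b c d e f g h i - mat9 a' b' c' d' e' f' g' h' i' =
   mat9 (a-a') (b-b') (c-c') (d-d') (e-e') (f-f') (g-g') (h-h') (i-i')"
  by (simp add: vec3_eq_iff)

lemma mat9_zero: "0 = mat9 0 0 0 0 0 0 0 0 0"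
  by (simp add: vec3_eq_iff)

lemmas mat9_simps = mat9_mult mat9_mult_vec mat9_transpose mat9_det mat9_one mat9_trace mat9_add
  mat9_scaleR mat9_diff mat9_eq_iff vector3_eq_iff

lemma diag3_mat9: "diag3 x y z = mat9 x 0 0 0 y 0 0 0 z"
  by (simp add: diag3_def mat9_def)

lemma inner_vector3: "(vector [a, b, c] :: real^3) \<bullet> vector [x, y, z] = a*x + b*y + c*z"
  by (simp add: inner_vec_def sum_3)

lemma inner_matrix_transpose:
  fixes A :: "real^'n^'m"
  shows "(A *v x) \<bullet> y = x \<bullet> (transpose A *v y)"
  by (metis dot_lmul_matrix inner_commute transpose_matrix_vector)

section \<open>Group laws in SL(3,R) and SO(3)\<close>

lemma SL3_mult: "g \<in> SL3 \<Longrightarrow> h \<in> SL3 \<Longrightarrow> g ** h \<in> SL3"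
  by (simp add: SL3_def det_mul)

lemma SL3_one: "mat 1 \<in> SL3"
  by (simp add: SL3_def)

lemma SL3_transpose: "g \<in> SL3 \<Longrightarrow> transpose g \<in> SL3"
  by (simp add: SL3_def det_transpose)

lemma SL3_invertible: "g \<in> SL3 \<Longrightarrow> invertible g"
  by (simp add: SL3_def invertible_det_nz)

lemma matrix_inv_inverse:
  assumes "invertible A"
  shows "A ** matrix_inv A = mat 1 \<and> matrix_inv A ** A = mat 1"
  using assms unfolding invertible_def matrix_inv_def by (rule someI_ex)

lemma SL3_inv_left: "g \<in> SL3 \<Longrightarrow> matrix_inv g ** g = mat 1"
  and SL3_inv_right: "g \<in> SL3 \<Longrightarrow> g ** matrix_inv g = mat 1"
  using SL3_invertible matrix_inv_inverse by blast+

lemma SL3_inv: "g \<in> SL3 \<Longrightarrow> matrix_inv g \<in> SL3"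
  using SL3_inv_left[of g] unfolding SL3_def
  by (metis (mono_tags, lifting) det_I det_mul mem_Collect_eq mult.right_neutral)

lemma SL3_cancel_left: "g \<in> SL3 \<Longrightarrow> matrix_inv g ** (g ** a) = a"
  and SL3_cancel_right: "g \<in> SL3 \<Longrightarrow> g ** (matrix_inv g ** a) = a"
  by (simp_all add: matrix_mul_assoc SL3_inv_left SL3_inv_right)

lemma matrix_inv_unique_left:
  fixes a b :: "real^3^3"
  assumes "b ** a = mat 1" shows "matrix_inv a = b"
proof -
  have ab: "a ** b = mat 1" using assms matrix_left_right_inverse by blast
  then have "a ** matrix_inv a = mat 1"
    using assms invertible_def matrix_inv_inverse by blast
  then have "b ** (a ** matrix_inv a) = b" by simp
  then show ?thesis by (simp add: matrix_mul_assoc assms)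
qed

lemma SL3_inv_mult: "g \<in> SL3 \<Longrightarrow> h \<in> SL3 \<Longrightarrow> matrix_inv (g ** h) = matrix_inv h ** matrix_inv g"
  by (rule matrix_inv_unique_left) (metis SL3_cancel_left SL3_inv_left matrix_mul_assoc)

lemma SO3_iff: "k \<in> SO3 \<longleftrightarrow> transpose k ** k = mat 1 \<and> det k = 1"
  by (simp add: SO3_def rotation_matrix_def orthogonal_matrix)

lemma SO3_SL3: "k \<in> SO3 \<Longrightarrow> k \<in> SL3"
  by (simp add: SO3_iff SL3_def)

lemma SO3_transpose_right: "k \<in> SO3 \<Longrightarrow> k ** transpose k = mat 1"
  using SO3_iff matrix_left_right_inverse by blast

lemma SO3_inv: "k \<in> SO3 \<Longrightarrow> matrix_inv k = transpose k"
  by (simp add: SO3_iff matrix_inv_unique_left)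

lemma SO3_transpose: "k \<in> SO3 \<Longrightarrow> transpose k \<in> SO3"
  by (simp add: SO3_iff det_transpose SO3_transpose_right)

lemma SO3_mult: "k \<in> SO3 \<Longrightarrow> l \<in> SO3 \<Longrightarrow> k ** l \<in> SO3"
  unfolding SO3_iff
  by (metis (no_types, lifting) det_mul matrix_mul_assoc matrix_mul_rid matrix_transpose_mul mult_1)

lemma SO3_one: "mat 1 \<in> SO3"
  by (simp add: SO3_iff)

lemma norm_SO3_mult: "k \<in> SO3 \<Longrightarrow> norm (k *v x) = norm x"
  by (simp add: norm_eq inner_matrix_transpose matrix_vector_mul_assoc SO3_iff)

section \<open>The action on cosets\<close>

lemma act_act: "act g (act h x) = act (g ** h) x"
  by (auto simp: act_def image_image matrix_mul_assoc)

lemma act_one: "act (mat 1) x = x"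
  by (simp add: act_def)

lemma act_SO3: assumes "k \<in> SO3" shows "act k basept = basept"
proof
  show "act k basept \<subseteq> basept" using assms by (auto simp: act_def basept_def SO3_mult)
  show "basept \<subseteq> act k basept"
  proof
    fix x assume x: "x \<in> basept"
    have "x = k ** (transpose k ** x)"
      by (simp add: matrix_mul_assoc SO3_transpose_right assms)
    then show "x \<in> act k basept"
      using x SO3_mult[OF SO3_transpose[OF assms], of x] unfolding act_def basept_def by blast
  qed
qed

text \<open>A factor from \<open>SO3\<close> on the right drops out of
  \<open>g ** transpose g\<close>; conversely \<open>matrix_inv h ** g\<close> is orthogonal once
  the two products agree. Points of \<open>spaceX\<close> are thus recorded by symmetric matrices,
  and equality of cosets becomes a computation with entries.\<close>

lemma coset_eq_iff:
  assumes "g \<in> SL3" "h \<in> SL3"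
  shows "act g basept = act h basept \<longleftrightarrow> g ** transpose g = h ** transpose h"
proof
  assume eq: "act g basept = act h basept"
  have "g \<in> act g basept" using SO3_one by (force simp: act_def basept_def)
  then obtain k where k: "k \<in> SO3" "g = h ** k" unfolding eq by (auto simp: act_def basept_def)
  show "g ** transpose g = h ** transpose h"
    unfolding k(2) using SO3_transpose_right[OF k(1)]
    by (metis matrix_mul_assoc matrix_mul_rid matrix_transpose_mul)
next
  assume eq: "g ** transpose g = h ** transpose h"
  define k where "k = matrix_inv h ** g"
  have kS: "k \<in> SL3" by (simp add: k_def SL3_mult SL3_inv assms)
  have "k ** transpose k = matrix_inv h ** (g ** transpose g) ** transpose (matrix_inv h)"
    by (simp add: k_def matrix_transpose_mul matrix_mul_assoc)
  also have "\<dots> = (matrix_inv h ** h) ** transpose (matrix_inv h ** h)"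
    by (simp only: eq matrix_transpose_mul matrix_mul_assoc)
  also have "\<dots> = mat 1" by (simp add: SL3_inv_left assms)
  finally have "transpose k ** k = mat 1" using matrix_left_right_inverse by blast
  then have "k \<in> SO3" using kS by (simp add: SO3_iff SL3_def)
  moreover have "g = h ** k" by (simp add: k_def SL3_cancel_right assms)
  ultimately show "act g basept = act h basept" by (metis act_act act_SO3)
qed

section \<open>Invariant inner products on the tangent space\<close>

text \<open>For a unit vector \<xi> this is the traceless part of the orthogonal projection onto its
  line. Up to scale it is the gradient at the base point of ln |g^T \<xi>|^2.\<close>

definition line_form :: "real^3 \<Rightarrow> real^3^3" where
  "line_form \<xi> = (\<chi> i j. \<xi>$i * \<xi>$j) - (1/3) *\<^sub>R mat 1"

lemma line_form_mult: "line_form \<xi> *v x = (\<xi> \<bullet> x) *\<^sub>R \<xi> - (1/3) *\<^sub>R x"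
  by (simp add: vec3_eq_iff line_form_def matrix_vector_mult_def sum_3 inner_vec_def mat_def algebra_simps)

lemma line_form_tangent: "norm \<xi> = 1 \<Longrightarrow> line_form \<xi> \<in> tangent_o"
proof -
  assume "norm \<xi> = 1"
  then have "\<xi> \<bullet> \<xi> = 1" by (simp add: norm_eq_1)
  then show ?thesis
    by (auto simp: tangent_o_def vec3_eq_iff line_form_def transpose_def trace_def sum_3 inner_vec_def mat_def)
qed

lemma line_form_rotate:
  assumes "k \<in> SO3" shows "line_form (k *v \<xi>) = k ** line_form \<xi> ** transpose k"
proof (rule iffD2[OF matrix_eq], rule allI)
  fix x
  have "k *v (transpose k *v x) = x"
    by (simp add: matrix_vector_mul_assoc SO3_transpose_right assms)
  then show "line_form (k *v \<xi>) *v x = (k ** line_form \<xi> ** transpose k) *v x"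
    by (simp flip: matrix_vector_mul_assoc
         add: line_form_mult matrix_vector_mult_diff_distrib matrix_vector_mult_scaleR inner_matrix_transpose)
qed

lemma transpose_add: "transpose (A + C) = transpose A + transpose (C::real^'n^'m)"
  and transpose_diff: "transpose (A - C) = transpose A - transpose (C::real^'n^'m)"
  and transpose_scale: "transpose (r *\<^sub>R A) = r *\<^sub>R transpose (A::real^'n^'m)"
  by (simp_all add: transpose_def vec_eq_iff)

lemma tangent_diff: "A \<in> tangent_o \<Longrightarrow> C \<in> tangent_o \<Longrightarrow> A - C \<in> tangent_o"
  by (simp add: tangent_o_def transpose_diff trace_sub)

lemma tangent_scale:
  assumes "A \<in> tangent_o" shows "r *\<^sub>R A \<in> tangent_o"
proof -
  have "trace (r *\<^sub>R A) = r * trace A" by (simp add: trace_def sum_3 algebra_simps)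
  then show ?thesis using assms by (simp add: tangent_o_def transpose_scale)
qed

lemma tangent_conj:
  assumes "k \<in> SO3" "A \<in> tangent_o" shows "k ** A ** transpose k \<in> tangent_o"
proof -
  have "trace (k ** A ** transpose k) = trace (transpose k ** (k ** A))"
    by (rule trace_mul_sym)
  also have "\<dots> = trace A" using assms(1) by (simp add: matrix_mul_assoc SO3_iff)
  finally show ?thesis using assms(2)
    by (auto simp: tangent_o_def matrix_transpose_mul matrix_mul_assoc)
qed

locale invariant_inner =
  fixes B :: "real^3^3 \<Rightarrow> real^3^3 \<Rightarrow> real"
  assumes inv_metric: "invariant_metric B"
begin

lemma bil: "bilinear B"
  and sym: "A \<in> tangent_o \<Longrightarrow> C \<in> tangent_o \<Longrightarrow> B A C = B C A"
  and pos: "A \<in> tangent_o \<Longrightarrow> A \<noteq> 0 \<Longrightarrow> B A A > 0"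
  and conj_inv: "k \<in> SO3 \<Longrightarrow> A \<in> tangent_o \<Longrightarrow> C \<in> tangent_o \<Longrightarrow>
     B (k ** A ** transpose k) (k ** C ** transpose k) = B A C"
  using inv_metric unfolding invariant_metric_def by (auto simp: SO3_inv)

lemmas bil_simps = bilinear_ladd[OF bil] bilinear_radd[OF bil] bilinear_lmul[OF bil] bilinear_rmul[OF bil]
  bilinear_lsub[OF bil] bilinear_rsub[OF bil] bilinear_lzero[OF bil] bilinear_rzero[OF bil]

lemma nonneg: "A \<in> tangent_o \<Longrightarrow> B A A \<ge> 0"
  using pos[of A] by (cases "A = 0") (auto simp: bil_simps)

lemma cauchy_schwarz:
  assumes "A \<in> tangent_o" "V \<in> tangent_o"
  shows "B A V \<le> sqrt (B A A) * sqrt (B V V)"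
proof (cases "A = 0")
  case True then show ?thesis by (simp add: bil_simps)
next
  case False
  define a where "a = B A A"
  have a: "a > 0" using pos assms(1) False by (simp add: a_def)
  have "0 \<le> B (a *\<^sub>R V - B A V *\<^sub>R A) (a *\<^sub>R V - B A V *\<^sub>R A)"
    by (intro nonneg tangent_diff tangent_scale assms)
  also have "\<dots> = a * (a * B V V - (B A V)\<^sup>2)"
    using sym[OF assms] by (simp add: bil_simps a_def algebra_simps power2_eq_square)
  finally have "(B A V)\<^sup>2 \<le> a * B V V"
    using a by (simp add: zero_le_mult_iff)
  then have "sqrt ((B A V)\<^sup>2) \<le> sqrt (a * B V V)" by (rule real_sqrt_le_mono)
  then show ?thesis by (simp add: a_def real_sqrt_mult)
qed

text \<open>The trace form gives \<open>line_form\<close> of a unit vector the squared norm 2/3, so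
  the factor 3/2 makes \<open>scal\<close> the ratio of \<open>B\<close> to the trace form on
  \<open>tangent_o\<close>.\<close>

definition scal :: real where
  "scal = 3/2 * B (line_form (axis 3 1)) (line_form (axis 3 1))"

lemma line_form_axis3: "line_form (axis 3 1) = mat9 (-1/3) 0 0 0 (-1/3) 0 0 0 (2/3)"
  by (simp add: vec3_eq_iff line_form_def axis_def mat_def)

lemma scal_pos: "scal > 0"
proof -
  have "line_form (axis 3 1) \<noteq> 0" by (simp add: line_form_axis3 mat9_zero mat9_eq_iff)
  moreover have "norm (axis 3 1 :: real^3) = 1" by simp
  ultimately show ?thesis
    unfolding scal_def using pos[OF line_form_tangent[of "axis 3 1"]] by simp
qed

text \<open>Averaging over the rotations by quarter turns about the third axis leaves only multiples of
  the form of that axis.\<close>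

lemma axis3_form:
  assumes "v \<in> tangent_o"
  shows "B (line_form (axis 3 1)) v = scal * v$3$3"
proof -
  define T where "T = line_form (axis 3 1)"
  have T: "T \<in> tangent_o" unfolding T_def by (rule line_form_tangent) simp
  define k where "k = mat9 0 (-1) 0 1 0 0 0 0 1"
  have k: "k \<in> SO3" by (simp add: k_def SO3_iff mat9_simps)
  define R where "R = (\<lambda>w. k ** w ** transpose k)"
  have RT: "R T = T" by (simp add: R_def T_def line_form_axis3 k_def mat9_simps)
  have inv: "B T (R w) = B T w" and Rt: "R w \<in> tangent_o" if "w \<in> tangent_o" for w
    using conj_inv[OF k T that] RT tangent_conj[OF k that] by (auto simp: R_def)
  obtain a b c d e f g h i where v: "v = mat9 a b c d e f g h i" using mat9_eta[of v] by blast
  have vs: "d = b" "g = c" "h = f" "a = - e - i"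
  proof -
    have "transpose v = v" "trace v = 0" using assms by (auto simp: tangent_o_def)
    then have "b = d \<and> c = g \<and> f = h" "a + e + i = 0"
      unfolding v mat9_transpose mat9_trace mat9_eq_iff by blast+
    then show "d = b" "g = c" "h = f" "a = - e - i" by linarith+
  qed
  have "v + R v + R (R v) + R (R (R v)) = (6 * i) *\<^sub>R T"
    unfolding T_def line_form_axis3 v vs R_def k_def by (simp add: mat9_simps)
  then have "B T (v + R v + R (R v) + R (R (R v))) = 6 * i * B T T" by (simp add: bil_simps)
  then have "4 * B T v = 6 * i * B T T" by (simp add: bil_simps inv Rt assms)
  then show ?thesis by (simp add: scal_def v flip: T_def) (simp add: algebra_simps)
qed

text \<open>A rotation taking the third axis to \<xi> reduces this to \<open>axis3_form\<close>. It
  identifies \<open>B\<close> with the quadratic forms that appear when squared lengths are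
  differentiated.\<close>

lemma line_form_pairing:
  assumes "norm \<xi> = 1" "v \<in> tangent_o"
  shows "B (line_form \<xi>) v = scal * (\<xi> \<bullet> (v *v \<xi>))"
proof -
  let ?e = "axis 3 1 :: real^3"
  obtain f where f: "orthogonal_transformation f" "det (matrix f) = 1" "f ?e = \<xi>"
    using rotation_exists[of ?e \<xi>] assms(1) by auto
  define k where "k = matrix f"
  have k: "k \<in> SO3"
    using f orthogonal_transformation_matrix[of f] by (simp add: k_def SO3_iff orthogonal_matrix)
  have ke: "k *v ?e = \<xi>"
    using f by (simp add: k_def matrix_works orthogonal_transformation_linear)
  define w where "w = transpose k ** v ** k"
  have w: "w \<in> tangent_o" using tangent_conj[OF SO3_transpose[OF k] assms(2)] by (simp add: w_def)
  have "k ** w ** transpose k = (k ** transpose k) ** v ** (k ** transpose k)"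
    by (simp only: w_def matrix_mul_assoc)
  then have v: "v = k ** w ** transpose k" by (simp add: SO3_transpose_right k)
  have "B (line_form \<xi>) v = B (line_form ?e) w"
    unfolding v ke[symmetric] line_form_rotate[OF k]
    by (rule conj_inv[OF k line_form_tangent w]) simp
  also have "\<dots> = scal * (?e \<bullet> (w *v ?e))"
    by (simp add: axis3_form[OF w] inner_axis' matrix_vector_mul_component)
       (simp add: inner_axis)
  also have "?e \<bullet> (w *v ?e) = \<xi> \<bullet> (v *v \<xi>)"
    by (simp add: w_def ke inner_matrix_transpose flip: matrix_vector_mul_assoc)
       (simp add: ke[symmetric] inner_matrix_transpose)
  finally show ?thesis .
qed

text \<open>The norm depends on \<xi> and \<eta> only through their orthogonality. This makes the
  Lipschitz constant in \<open>busemann_curve_bound\<close> the same at every point.\<close>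

lemma pair_form_norm:
  fixes a b :: real
  assumes "norm \<xi> = 1" "norm \<eta> = 1" "\<xi> \<bullet> \<eta> = 0"
  defines "T \<equiv> b *\<^sub>R line_form \<xi> - a *\<^sub>R line_form \<eta>"
  shows "T \<in> tangent_o" "B T T = 2 * scal * (a\<^sup>2 + b\<^sup>2 + a * b) / 3"
    "v \<in> tangent_o \<Longrightarrow> B T v = scal * (b * (\<xi> \<bullet> (v *v \<xi>)) - a * (\<eta> \<bullet> (v *v \<eta>)))"
proof -
  show T: "T \<in> tangent_o"
    unfolding T_def by (intro tangent_diff tangent_scale line_form_tangent assms)
  show Tv: "B T v = scal * (b * (\<xi> \<bullet> (v *v \<xi>)) - a * (\<eta> \<bullet> (v *v \<eta>)))" if "v \<in> tangent_o" for v
    using line_form_pairing[OF assms(1) that] line_form_pairing[OF assms(2) that]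
    by (simp add: T_def bil_simps algebra_simps)
  have n: "\<xi> \<bullet> \<xi> = 1" "\<eta> \<bullet> \<eta> = 1" "\<eta> \<bullet> \<xi> = 0"
    using assms by (auto simp: norm_eq_1 inner_commute)
  have Tx: "T *v x = b *\<^sub>R ((\<xi> \<bullet> x) *\<^sub>R \<xi> - (1/3) *\<^sub>R x) - a *\<^sub>R ((\<eta> \<bullet> x) *\<^sub>R \<eta> - (1/3) *\<^sub>R x)" for x
    by (simp add: T_def matrix_vector_mult_diff_rdistrib line_form_mult flip: scaleR_matrix_vector_assoc)
  have e: "\<xi> \<bullet> (T *v \<xi>) = 2*b/3 + a/3" "\<eta> \<bullet> (T *v \<eta>) = - b/3 - 2*a/3"
    unfolding Tx by (simp_all add: inner_diff_right inner_add_right n assms(3) algebra_simps)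
  show "B T T = 2 * scal * (a\<^sup>2 + b\<^sup>2 + a * b) / 3"
    unfolding Tv[OF T] e by (simp add: power2_eq_square algebra_simps)
qed

lemma diag_norm:
  assumes "x + y + z = 0"
  shows "B (diag3 x y z) (diag3 x y z) = scal * (x\<^sup>2 + y\<^sup>2 + z\<^sup>2)"
proof -
  let ?D = "diag3 x y z"
  have D: "?D \<in> tangent_o" using assms by (simp add: tangent_o_def diag3_mat9 mat9_simps)
  have a1: "axis 1 1 = (vector [1, 0, 0] :: real^3)" and a3: "axis 3 1 = (vector [0, 0, 1] :: real^3)"
    and a2: "axis 2 1 = (vector [0, 1, 0] :: real^3)"
    by (simp_all add: vec3_eq_iff axis_def)
  \<comment> \<open>The multiples of the identity in the three line forms cancel because
    \<open>x + y + z = 0\<close>.\<close>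
  have eq: "?D = x *\<^sub>R line_form (axis 1 1) + y *\<^sub>R line_form (axis 2 1) + z *\<^sub>R line_form (axis 3 1)"
    using assms by (simp add: vec3_eq_iff line_form_def axis_def mat_def diag3_mat9 algebra_simps)

  have "B ?D ?D = x * B (line_form (axis 1 1)) ?D + y * B (line_form (axis 2 1)) ?D + z * B (line_form (axis 3 1)) ?D"
    by (subst eq) (simp add: bil_simps)
  also have "\<dots> = scal * (x\<^sup>2 + y\<^sup>2 + z\<^sup>2)"
    using D by (simp add: line_form_pairing)
      (simp add: a1 a2 a3 diag3_mat9 mat9_simps inner_vector3 power2_eq_square algebra_simps)
  finally show ?thesis .
qed

end

section \<open>Curves, Busemann functions and distances\<close>

text \<open>The adjugate is the diagonal of a bilinear map, which makes inversion differentiable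
  along curves.\<close>

definition cof :: "real^3^3 \<Rightarrow> real^3^3 \<Rightarrow> real^3^3" where
  "cof M N = mat9
     (M$2$2 * N$3$3 - M$2$3 * N$3$2) (M$1$3 * N$3$2 - M$1$2 * N$3$3) (M$1$2 * N$2$3 - M$1$3 * N$2$2)
     (M$2$3 * N$3$1 - M$2$1 * N$3$3) (M$1$1 * N$3$3 - M$1$3 * N$3$1) (M$1$3 * N$2$1 - M$1$1 * N$2$3)
     (M$2$1 * N$3$2 - M$2$2 * N$3$1) (M$1$2 * N$3$1 - M$1$1 * N$3$2) (M$1$1 * N$2$2 - M$1$2 * N$2$1)"

lemma SL3_inv_cof:
  assumes "g \<in> SL3" shows "matrix_inv g = cof g g"
proof (rule matrix_inv_unique_left)
  obtain a b c d e f p q r where g: "g = mat9 a b c d e f p q r" using mat9_eta by blast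
  have det: "det g = 1" using assms by (simp add: SL3_def)
  have "cof g g ** g = det g *\<^sub>R mat 1"
    unfolding g by (simp add: cof_def mat9_simps) algebra
  then show "cof g g ** g = mat 1" by (simp add: det)
qed

lemma bilinear_cof: "bounded_bilinear cof"
  unfolding bilinear_conv_bounded_bilinear[symmetric] bilinear_def cof_def
  by (auto intro!: linearI simp: mat9_add mat9_scaleR mat9_eq_iff algebra_simps)

lemma bilinear_matrix_mult: "bounded_bilinear ((**) :: real^3^3 \<Rightarrow> real^3^3 \<Rightarrow> real^3^3)"
  unfolding bilinear_conv_bounded_bilinear[symmetric] bilinear_def
  by (auto intro!: linearI simp: vec3_eq_iff matrix_matrix_mult_def sum_3 algebra_simps)

lemma bilinear_matrix_vector: "bounded_bilinear ((*v) :: real^3^3 \<Rightarrow> real^3 \<Rightarrow> real^3)"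
  unfolding bilinear_conv_bounded_bilinear[symmetric] bilinear_def
  by (auto intro!: linearI simp: vec3_eq_iff matrix_vector_mult_def sum_3 algebra_simps)

lemma linear_transpose: "bounded_linear (transpose :: real^3^3 \<Rightarrow> real^3^3)"
  unfolding linear_conv_bounded_linear[symmetric]
  by (rule linearI) (simp_all add: transpose_add transpose_scale)

lemmas matrix_deriv_mult = bounded_bilinear.has_vector_derivative[OF bilinear_matrix_mult]
lemmas matrix_cont_mult = bounded_bilinear.continuous_on[OF bilinear_matrix_mult]

lemma C1_matrix_mult:
  fixes c d :: "real \<Rightarrow> real^3^3"
  assumes "c C1_differentiable_on S" "d C1_differentiable_on S"
  shows "(\<lambda>t. c t ** d t) C1_differentiable_on S"
proof -
  obtain C where C: "\<And>t. t \<in> S \<Longrightarrow> (c has_vector_derivative C t) (at t)" "continuous_on S C"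
    using assms(1) unfolding C1_differentiable_on_def by blast
  obtain D where D: "\<And>t. t \<in> S \<Longrightarrow> (d has_vector_derivative D t) (at t)" "continuous_on S D"
    using assms(2) unfolding C1_differentiable_on_def by blast
  have "continuous_on S c" "continuous_on S d"
    using C(1) D(1) by (meson continuous_at_imp_continuous_on has_vector_derivative_continuous)+
  then have "continuous_on S (\<lambda>t. c t ** D t + C t ** d t)"
    by (intro continuous_on_add matrix_cont_mult C D)
  moreover have "((\<lambda>t. c t ** d t) has_vector_derivative (c t ** D t + C t ** d t)) (at t)" if "t \<in> S" for t
    by (rule matrix_deriv_mult[OF C(1)[OF that] D(1)[OF that]])
  ultimately show ?thesis unfolding C1_differentiable_on_def
    by (intro exI[of _ "\<lambda>t. c t ** D t + C t ** d t"]) simp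
qed

lemma C1_matrix_const: "(\<lambda>t. M :: real^3^3) C1_differentiable_on S"
  unfolding C1_differentiable_on_def by (auto intro!: exI[of _ "\<lambda>_. 0"] derivative_eq_intros)

section \<open>Diagonal one-parameter groups and the curves built from them\<close>

lemma diag3_mult: "diag3 a b c ** diag3 x y z = diag3 (a*x) (b*y) (c*z)"
  by (simp add: diag3_mat9 mat9_simps)

lemma diag3_one: "diag3 1 1 1 = mat 1"
  by (simp add: diag3_mat9 mat9_one)

lemma diag3_transpose: "transpose (diag3 x y z) = diag3 x y z"
  by (simp add: diag3_mat9 mat9_simps)

definition exp_diag :: "real \<Rightarrow> real \<Rightarrow> real \<Rightarrow> real^3^3" where
  "exp_diag x y z = diag3 (exp x) (exp y) (exp z)"

lemma exp_diag_mult: "exp_diag a b c ** exp_diag x y z = exp_diag (a+x) (b+y) (c+z)"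
  by (simp add: exp_diag_def diag3_mult exp_add)

lemma exp_diag_zero: "exp_diag 0 0 0 = mat 1"
  by (simp add: exp_diag_def diag3_one)

lemma exp_diag_transpose: "transpose (exp_diag x y z) = exp_diag x y z"
  by (simp add: exp_diag_def diag3_transpose)

lemma exp_diag_SL3: "x + y + z = 0 \<Longrightarrow> exp_diag x y z \<in> SL3"
  by (simp add: exp_diag_def SL3_def diag3_mat9 mat9_simps flip: exp_add)

lemma exp_diag_inv: "matrix_inv (exp_diag x y z) = exp_diag (-x) (-y) (-z)"
  by (rule matrix_inv_unique_left) (simp add: exp_diag_mult exp_diag_zero)

lemma exp_diag_deriv:
  "((\<lambda>t. exp_diag (\<alpha> + t * x) (\<beta> + t * y) (\<gamma> + t * z)) has_vector_derivative
     exp_diag (\<alpha> + t * x) (\<beta> + t * y) (\<gamma> + t * z) ** diag3 x y z) (at t)"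
proof -
  have dec: "diag3 p q r = p *\<^sub>R diag3 1 0 0 + q *\<^sub>R diag3 0 1 0 + r *\<^sub>R diag3 0 0 1" for p q r
    by (simp add: diag3_mat9 mat9_simps)
  have e: "((\<lambda>t. exp (\<delta> + t * w) *\<^sub>R M) has_vector_derivative (exp (\<delta> + t * w) * w) *\<^sub>R M) (at t)"
    for \<delta> w and M :: "real^3^3"
  proof -
    have "((\<lambda>t. exp (\<delta> + t * w)) has_real_derivative exp (\<delta> + t * w) * w) (at t)"
      by (auto intro!: derivative_eq_intros)
    from has_vector_derivative_scaleR[OF this has_vector_derivative_const[of M]]
    show ?thesis by simp
  qed
  show ?thesis unfolding exp_diag_def diag3_mult
    by (subst (1 2) dec) (intro has_vector_derivative_add e)
qed

lemma exp_diag_C1: "(\<lambda>t. exp_diag (\<alpha> + t * x) (\<beta> + t * y) (\<gamma> + t * z)) C1_differentiable_on S"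
  unfolding C1_differentiable_on_def
proof (intro exI conjI ballI)
  show "continuous_on S (\<lambda>t. exp_diag (\<alpha> + t * x) (\<beta> + t * y) (\<gamma> + t * z) ** diag3 x y z)"
    by (intro matrix_cont_mult continuous_on_const)
       (intro continuous_at_imp_continuous_on ballI has_vector_derivative_continuous[OF exp_diag_deriv])
qed (rule exp_diag_deriv)

text \<open>Nonemptiness matters because \<open>distX\<close> is a real infimum. The factor
  \<open>M\<close> runs back to the identity while \<open>N\<close> runs out from it, and the
  rotation \<open>transpose k ** l\<close> between them only changes the representative of the
  starting coset. Multiplying instead of concatenating keeps the curve C1 and needs no path inside
  \<open>SO3\<close>.\<close>

lemma curves_nonempty:
  assumes "k \<in> SO3" "l \<in> SO3" "x + y + z = 0" "x' + y' + z' = 0"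
  shows "curves (act (k ** exp_diag x y z) basept) (act (l ** exp_diag x' y' z') basept) \<noteq> {}"
proof -
  define M where "M = (\<lambda>t. exp_diag (x + t * (-x)) (y + t * (-y)) (z + t * (-z)))"
  define N where "N = (\<lambda>t. exp_diag (0 + t * x') (0 + t * y') (0 + t * z'))"
  define c where "c = (\<lambda>t. k ** (M t ** (transpose k ** (l ** N t))))"
  have "c C1_differentiable_on {0..1}"
    unfolding c_def M_def N_def by (intro C1_matrix_mult C1_matrix_const exp_diag_C1)
  moreover have "c t \<in> SL3" for t
  proof -
    have "x + t * (-x) + (y + t * (-y)) + (z + t * (-z)) = (x + y + z) * (1 - t)"
      "0 + t * x' + (0 + t * y') + (0 + t * z') = t * (x' + y' + z')"
      by (simp_all add: algebra_simps)
    then show ?thesis unfolding c_def M_def N_def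
      using assms by (intro SL3_mult exp_diag_SL3 SO3_SL3 SO3_transpose) simp_all
  qed
  moreover have "act (c 0) basept = act (k ** exp_diag x y z) basept"
  proof -
    have "c 0 = (k ** exp_diag x y z) ** (transpose k ** l)"
      by (simp add: c_def M_def N_def exp_diag_zero matrix_mul_assoc)
    then show ?thesis by (metis act_act act_SO3 SO3_mult SO3_transpose assms(1,2))
  qed
  moreover have "c 1 = l ** exp_diag x' y' z'"
    using SO3_transpose_right[OF assms(1)] by (simp add: c_def M_def N_def exp_diag_zero matrix_mul_assoc)
  ultimately have "c \<in> curves (act (k ** exp_diag x y z) basept) (act (l ** exp_diag x' y' z') basept)"
    unfolding curves_def by auto
  then show ?thesis by blast
qed

text \<open>The curve is known to lie in \<open>SL3\<close> only on {0..1}. Hence det = 1 and the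
  equation for the inverse are differentiated within that interval, where derivatives are unique
  even at the endpoints.\<close>

lemma SL3_curve_deriv:
  assumes c: "\<And>t. t \<in> {0..1} \<Longrightarrow> c t \<in> SL3" and t: "t \<in> {0..1}"
    and D: "(c has_vector_derivative D) (at t)"
  shows "trace (matrix_inv (c t) ** D) = 0"
    and "((\<lambda>s. cof (c s) (c s)) has_vector_derivative - (matrix_inv (c t) ** D ** matrix_inv (c t))) (at t)"
proof -
  note cS = c[OF t]
  have ent: "((\<lambda>s. c s $ i $ j) has_real_derivative D $ i $ j) (at t)" for i j
  proof -
    have "((\<lambda>s. c s $ i $ j) has_vector_derivative D $ i $ j) (at t)"
      by (intro bounded_linear.has_vector_derivative[OF bounded_linear_vec_nth] D)
    then show ?thesis by (simp add: has_real_derivative_iff_has_vector_derivative)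
  qed
  \<comment> \<open>Jacobi's formula, with the adjugate \<open>cof (c t) (c t)\<close>.\<close>
  have "((\<lambda>s. det (c s)) has_real_derivative trace (cof (c t) (c t) ** D)) (at t)"
    unfolding det_3
    by (rule derivative_eq_intros ent refl)+
      (simp add: cof_def trace_def matrix_matrix_mult_def sum_3 algebra_simps)
  moreover have "((\<lambda>s. det (c s)) has_real_derivative 0) (at t within {0..1})"
    unfolding has_real_derivative_iff_has_vector_derivative
    by (rule has_vector_derivative_transform[OF t, of _ "\<lambda>_. 1"])
       (use c in \<open>auto simp: SL3_def\<close>)
  ultimately have "trace (cof (c t) (c t) ** D) = 0"
    unfolding has_real_derivative_iff_has_vector_derivative
    using vector_derivative_unique_within_closed_interval[of 0 1 t "\<lambda>s. det (c s)"] t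
      has_vector_derivative_at_within by fastforce
  then show "trace (matrix_inv (c t) ** D) = 0" by (simp add: SL3_inv_cof[OF cS])
  define W where "W = cof (c t) D + cof D (c t)"
  have W: "((\<lambda>s. cof (c s) (c s)) has_vector_derivative W) (at t)"
    unfolding W_def by (intro bounded_bilinear.has_vector_derivative[OF bilinear_cof] D)
  have "((\<lambda>s. cof (c s) (c s) ** c s) has_vector_derivative (cof (c t) (c t) ** D + W ** c t)) (at t within {0..1})"
    by (intro has_vector_derivative_at_within[OF matrix_deriv_mult] D W)
  moreover have "((\<lambda>s. cof (c s) (c s) ** c s) has_vector_derivative 0) (at t within {0..1})"
    by (rule has_vector_derivative_transform[OF t, of _ "\<lambda>_. mat 1"])
       (use c SL3_inv_left in \<open>auto simp flip: SL3_inv_cof\<close>)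
  ultimately have "cof (c t) (c t) ** D + W ** c t = 0"
    using vector_derivative_unique_within_closed_interval[of 0 1 t] t by fastforce
  then have "W ** c t = - (matrix_inv (c t) ** D)"
    by (simp add: SL3_inv_cof[OF cS] eq_neg_iff_add_eq_0 add.commute)
  then have "W ** (c t ** matrix_inv (c t)) = - (matrix_inv (c t) ** D) ** matrix_inv (c t)"
    by (simp add: matrix_mul_assoc)
  then have "W = - (matrix_inv (c t) ** D ** matrix_inv (c t))"
    by (simp add: SL3_inv_right[OF cS] bounded_bilinear.minus_left[OF bilinear_matrix_mult])
  with W show "((\<lambda>s. cof (c s) (c s)) has_vector_derivative - (matrix_inv (c t) ** D ** matrix_inv (c t))) (at t)"
    by simp
qed

text \<open>For \<open>p\<close> orthogonal to \<open>q\<close>, this is up to sign and scale the Busemann function of a boundary point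
  at infinity of \<open>spaceX\<close>; all boundary points arise in this way.\<close>

definition busemann :: "real \<Rightarrow> real \<Rightarrow> real^3 \<Rightarrow> real^3 \<Rightarrow> real^3^3 \<Rightarrow> real" where
  "busemann a b p q g =
     b * ln ((transpose g *v p) \<bullet> (transpose g *v p)) + a * ln ((matrix_inv g *v q) \<bullet> (matrix_inv g *v q))"

lemma matrix_vector_nonzero:
  fixes x :: "real^3"
  assumes "a ** g = mat 1" "x \<noteq> 0" shows "g *v x \<noteq> 0"
proof
  assume "g *v x = 0"
  then have "a *v (g *v x) = 0" by simp
  then show False using assms by (simp add: matrix_vector_mul_assoc)
qed

lemma busemann_coset:
  assumes "g \<in> SL3" "h \<in> SL3" "act g basept = act h basept"
  shows "busemann a b p q g = busemann a b p q h"
proof -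
  have eq: "g ** transpose g = h ** transpose h" using assms coset_eq_iff by blast
  have 1: "(transpose g *v p) \<bullet> (transpose g *v p) = p \<bullet> ((g ** transpose g) *v p)" for g :: "real^3^3"
    by (simp add: inner_matrix_transpose matrix_vector_mul_assoc)
  have 2: "(matrix_inv g *v q) \<bullet> (matrix_inv g *v q) = q \<bullet> (matrix_inv (g ** transpose g) *v q)"
    if "g \<in> SL3" for g :: "real^3^3"
  proof -
    have "transpose (matrix_inv g) ** transpose g = mat 1"
      using that by (metis SL3_inv_right matrix_transpose_mul transpose_mat)
    then have "matrix_inv (transpose g) = transpose (matrix_inv g)"
      by (rule matrix_inv_unique_left)
    then show ?thesis
      by (simp add: inner_matrix_transpose matrix_vector_mul_assoc SL3_inv_mult SL3_transpose that)
  qed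
  show ?thesis unfolding busemann_def 1 using 2 eq assms by simp
qed

text \<open>Writing c' = c v, one has x' = v^T x and y' = - v y, and only the symmetric part of v
  changes their squared lengths. The inverse is expressed by \<open>cof\<close>, since at the
  endpoints of {0..1} the two-sided derivative also sees times at which the curve may have left
  \<open>SL3\<close>.\<close>

lemma busemann_deriv:
  assumes c: "\<And>t. t \<in> {0..1} \<Longrightarrow> c t \<in> SL3" and t: "t \<in> {0..1}"
    and D: "(c has_vector_derivative D) (at t)" and "p \<noteq> 0" "q \<noteq> 0"
  defines "V \<equiv> sym_part (matrix_inv (c t) ** D)"
    and "x \<equiv> transpose (c t) *v p" and "y \<equiv> matrix_inv (c t) *v q"
  shows "((\<lambda>s. b * ln ((transpose (c s) *v p) \<bullet> (transpose (c s) *v p))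
            + a * ln ((cof (c s) (c s) *v q) \<bullet> (cof (c s) (c s) *v q))) has_real_derivative
          2 * (b * (x \<bullet> (V *v x)) / (x \<bullet> x) - a * (y \<bullet> (V *v y)) / (y \<bullet> y))) (at t)"
proof -
  note cS = c[OF t]
  define v where "v = matrix_inv (c t) ** D"
  have Dv: "D = c t ** v" by (simp only: v_def SL3_cancel_right[OF cS])
  have vt: "z \<bullet> (transpose v *v z) = z \<bullet> (v *v z)" for z
    by (metis inner_commute inner_matrix_transpose)
  have Vq: "z \<bullet> (V *v z) = z \<bullet> (v *v z)" for z
    by (simp add: V_def sym_part_def matrix_vector_mult_add_rdistrib inner_add_right vt
        flip: v_def scaleR_matrix_vector_assoc)
  have x0: "x \<noteq> 0" unfolding x_def
    by (rule matrix_vector_nonzero[OF _ \<open>p \<noteq> 0\<close>, of "transpose (matrix_inv (c t))"])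
       (metis SL3_inv_right cS matrix_transpose_mul transpose_mat)
  have y0: "y \<noteq> 0" unfolding y_def
    by (rule matrix_vector_nonzero[OF _ \<open>q \<noteq> 0\<close>, of "c t"]) (simp add: SL3_inv_right[OF cS])
  have mv: "((\<lambda>s. m s *v w) has_vector_derivative M *v w) (at t)"
    if "(m has_vector_derivative M) (at t)" for m and M :: "real^3^3" and w :: "real^3"
    using bounded_bilinear.has_vector_derivative[OF bilinear_matrix_vector that, of "\<lambda>_. w" 0]
    by simp
  have sq: "((\<lambda>s. w s \<bullet> w s) has_real_derivative 2 * (w t \<bullet> w')) (at t)"
    if "(w has_vector_derivative w') (at t)" for w :: "real \<Rightarrow> real^3" and w'
    using bounded_bilinear.has_vector_derivative[OF bounded_bilinear_inner that that]
    by (simp add: has_real_derivative_iff_has_vector_derivative inner_commute)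
  have "((\<lambda>s. transpose (c s) *v p) has_vector_derivative transpose v *v x) (at t)"
  proof -
    have "((\<lambda>s. transpose (c s)) has_vector_derivative transpose D) (at t)"
      by (rule bounded_linear.has_vector_derivative[OF linear_transpose D])
    moreover have "transpose D *v p = transpose v *v x"
      unfolding x_def by (subst Dv) (simp only: matrix_transpose_mul matrix_vector_mul_assoc)
    ultimately show ?thesis using mv[of "\<lambda>s. transpose (c s)" "transpose D" p] by simp
  qed
  from sq[OF this] have dx: "((\<lambda>s. (transpose (c s) *v p) \<bullet> (transpose (c s) *v p)) has_real_derivative
      2 * (x \<bullet> (V *v x))) (at t)"
    by (simp add: Vq vt flip: x_def)
  have "((\<lambda>s. cof (c s) (c s) *v q) has_vector_derivative - (v *v y)) (at t)"
  proof -
    have "- (matrix_inv (c t) ** D ** matrix_inv (c t)) *v q = - (v *v y)"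
      by (simp only: v_def y_def matrix_vector_mul_assoc bounded_bilinear.minus_left[OF bilinear_matrix_vector])
    then show ?thesis
      using mv[of "\<lambda>s. cof (c s) (c s)" _ q, OF SL3_curve_deriv(2)[OF c t D]] by simp
  qed
  from sq[OF this] have dy: "((\<lambda>s. (cof (c s) (c s) *v q) \<bullet> (cof (c s) (c s) *v q)) has_real_derivative
      - 2 * (y \<bullet> (V *v y))) (at t)"
    by (simp add: Vq y_def SL3_inv_cof[OF cS])
  have xt: "(transpose (c t) *v p) \<bullet> (transpose (c t) *v p) = x \<bullet> x" "x \<bullet> x > 0"
    and yt: "(cof (c t) (c t) *v q) \<bullet> (cof (c t) (c t) *v q) = y \<bullet> y" "y \<bullet> y > 0"
    using x0 y0 by (simp_all add: x_def y_def SL3_inv_cof[OF cS])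
  have lnd: "((\<lambda>s. k * ln (u s)) has_real_derivative k * (d / u t)) (at t)"
    if "(u has_real_derivative d) (at t)" "u t > 0" for u :: "real \<Rightarrow> real" and d k
    using that by (auto intro!: derivative_eq_intros)
  have "b * (2 * (x \<bullet> (V *v x)) / (x \<bullet> x)) + a * (- 2 * (y \<bullet> (V *v y)) / (y \<bullet> y))
      = 2 * (b * (x \<bullet> (V *v x)) / (x \<bullet> x) - a * (y \<bullet> (V *v y)) / (y \<bullet> y))"
    by (simp add: algebra_simps)
  with DERIV_add[OF lnd[OF dx, of b] lnd[OF dy, of a]] show ?thesis
    unfolding xt(1) yt(1) using xt(2) yt(2) by simp
qed

section \<open>Lengths, the Lipschitz bound and invariance of the distance\<close>

context invariant_inner
begin

lemma sym_part_tangent: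
  assumes "trace A = 0" shows "sym_part A \<in> tangent_o"
proof -
  have "trace (sym_part A) = trace A"
    by (simp add: sym_part_def trace_def sum_3 transpose_def)
  then show ?thesis
    using assms by (simp add: tangent_o_def sym_part_def transpose_add transpose_scale add.commute)
qed

lemma speed_eq:
  assumes "(c has_vector_derivative D) (at t)"
  shows "speed B c t = sqrt (B (sym_part (matrix_inv (c t) ** D)) (sym_part (matrix_inv (c t) ** D)))"
  using assms by (simp add: speed_def Let_def vector_derivative_at)

lemma speed_nonneg:
  assumes "\<And>t. t \<in> {0..1} \<Longrightarrow> c t \<in> SL3" "t \<in> {0..1}" "(c has_vector_derivative D) (at t)"
  shows "speed B c t \<ge> 0"
  unfolding speed_eq[OF assms(3)]
  using nonneg[OF sym_part_tangent[OF SL3_curve_deriv(1)[OF assms]]] by simp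

lemma continuous_speed:
  assumes c: "c C1_differentiable_on {0..1}" "\<And>t. t \<in> {0..1} \<Longrightarrow> c t \<in> SL3"
  shows "continuous_on {0..1} (speed B c)"
proof -
  obtain D where D: "\<And>t. t \<in> {0..1} \<Longrightarrow> (c has_vector_derivative D t) (at t)" "continuous_on {0..1} D"
    using c(1) unfolding C1_differentiable_on_def by blast
  have cc: "continuous_on {0..1} c"
    using D(1) by (meson continuous_at_imp_continuous_on has_vector_derivative_continuous)
  let ?A = "\<lambda>t. cof (c t) (c t) ** D t"
  have A: "continuous_on {0..1} ?A"
    by (intro matrix_cont_mult bounded_bilinear.continuous_on[OF bilinear_cof] cc D)
  have S: "continuous_on {0..1} (\<lambda>t. sym_part (?A t))"
    unfolding sym_part_def
    by (intro continuous_intros A bounded_linear.continuous_on[OF linear_transpose])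
  have "continuous_on {0..1} (\<lambda>t. sqrt (B (sym_part (?A t)) (sym_part (?A t))))"
    by (intro continuous_on_real_sqrt bounded_bilinear.continuous_on[of B] S)
       (use bil bilinear_conv_bounded_bilinear in blast)
  then show ?thesis
    by (rule continuous_on_eq) (simp add: speed_eq[OF D(1)] SL3_inv_cof c(2))
qed

lemma curve_length_nonneg:
  assumes "c \<in> curves x y" shows "curve_length B c \<ge> 0"
proof -
  have c: "c C1_differentiable_on {0..1}" "\<And>t. t \<in> {0..1} \<Longrightarrow> c t \<in> SL3"
    using assms by (auto simp: curves_def)
  obtain D where D: "\<And>t. t \<in> {0..1} \<Longrightarrow> (c has_vector_derivative D t) (at t)"
    using c(1) unfolding C1_differentiable_on_def by blast
  show ?thesis unfolding curve_length_def
    by (intro integral_nonneg integrable_continuous_real continuous_speed c speed_nonneg[OF c(2) _ D])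
qed

lemma busemann_curve_bound:
  assumes "c \<in> curves x y" "p \<noteq> 0" "q \<noteq> 0" "p \<bullet> q = 0"
  shows "scal / 2 * (busemann a b p q (c 1) - busemann a b p q (c 0))
    \<le> sqrt (2 * scal * (a\<^sup>2 + b\<^sup>2 + a * b) / 3) * curve_length B c"
proof -
  define N where "N = sqrt (2 * scal * (a\<^sup>2 + b\<^sup>2 + a * b) / 3)"
  have c: "c C1_differentiable_on {0..1}" "\<And>t. t \<in> {0..1} \<Longrightarrow> c t \<in> SL3"
    using assms by (auto simp: curves_def)
  obtain D where D: "\<And>t. t \<in> {0..1} \<Longrightarrow> (c has_vector_derivative D t) (at t)"
    using c(1) unfolding C1_differentiable_on_def by blast
  define V where "V = (\<lambda>t. sym_part (matrix_inv (c t) ** D t))"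
  define X where "X = (\<lambda>t. transpose (c t) *v p)"
  define Y where "Y = (\<lambda>t. matrix_inv (c t) *v q)"
  define f where "f = (\<lambda>s. b * ln ((transpose (c s) *v p) \<bullet> (transpose (c s) *v p))
            + a * ln ((cof (c s) (c s) *v q) \<bullet> (cof (c s) (c s) *v q)))"
  define f' where "f' = (\<lambda>t. 2 * (b * (X t \<bullet> (V t *v X t)) / (X t \<bullet> X t) - a * (Y t \<bullet> (V t *v Y t)) / (Y t \<bullet> Y t)))"
  have "(f has_real_derivative f' t) (at t)" if "t \<in> {0..1}" for t
    unfolding f_def f'_def X_def Y_def V_def by (rule busemann_deriv[OF c(2) that D[OF that] assms(2,3)])
  then have "(f' has_integral (f 1 - f 0)) {0..1}"
    by (intro fundamental_theorem_of_calculus)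
       (auto simp: has_real_derivative_iff_has_vector_derivative intro: has_vector_derivative_at_within)
  moreover have "f s = busemann a b p q (c s)" if "s \<in> {0..1}" for s
    using that by (simp add: f_def busemann_def SL3_inv_cof c(2))
  ultimately have "(f' has_integral (busemann a b p q (c 1) - busemann a b p q (c 0))) {0..1}" by simp
  then have "((\<lambda>t. scal / 2 * f' t) has_integral scal / 2 * (busemann a b p q (c 1) - busemann a b p q (c 0))) {0..1}"
    by (rule has_integral_mult_right)
  moreover have "((\<lambda>t. N * speed B c t) has_integral N * curve_length B c) {0..1}"
    unfolding curve_length_def
    by (intro has_integral_mult_right integrable_integral integrable_continuous_real continuous_speed c)
  moreover have "scal / 2 * f' t \<le> N * speed B c t" if t: "t \<in> {0..1}" for t
  proof -
    have cS: "c t \<in> SL3" using c t by simp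
    define \<xi> where "\<xi> = X t /\<^sub>R norm (X t)"
    define \<eta> where "\<eta> = Y t /\<^sub>R norm (Y t)"
    have "X t \<noteq> 0" unfolding X_def
      by (rule matrix_vector_nonzero[OF _ \<open>p \<noteq> 0\<close>, of "transpose (matrix_inv (c t))"])
         (metis SL3_inv_right cS matrix_transpose_mul transpose_mat)
    moreover have "Y t \<noteq> 0" unfolding Y_def
      by (rule matrix_vector_nonzero[OF _ \<open>q \<noteq> 0\<close>, of "c t"]) (simp add: SL3_inv_right cS)
    \<comment> \<open>The inner product of g^T p and g^-1 q is that of p and q, so orthogonality
      persists along the whole curve.\<close>
    moreover have "X t \<bullet> Y t = 0"
      by (simp add: X_def Y_def inner_matrix_transpose matrix_vector_mul_assoc SL3_inv_right cS assms(4))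
    ultimately have n: "norm \<xi> = 1" "norm \<eta> = 1" "\<xi> \<bullet> \<eta> = 0"
      by (simp_all add: \<xi>_def \<eta>_def)
    have V: "V t \<in> tangent_o"
      unfolding V_def by (intro sym_part_tangent SL3_curve_deriv(1)[OF c(2) t D[OF t]])
    define T where "T = b *\<^sub>R line_form \<xi> - a *\<^sub>R line_form \<eta>"
    note T = pair_form_norm[OF n, where b = b and a = a, folded T_def]
    have q: "(z /\<^sub>R norm z) \<bullet> (M *v (z /\<^sub>R norm z)) = (z \<bullet> (M *v z)) / (z \<bullet> z)" for z :: "real^3" and M :: "real^3^3"
      by (simp add: matrix_vector_mult_scaleR dot_square_norm power2_eq_square divide_inverse)
    have "scal / 2 * f' t = B T (V t)"
      unfolding T(3)[OF V] \<xi>_def \<eta>_def q f'_def by (simp add: mult_ac)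
    also have "\<dots> \<le> sqrt (B T T) * sqrt (B (V t) (V t))" by (rule cauchy_schwarz[OF T(1) V])
    also have "\<dots> = N * speed B c t"
      unfolding T(2) N_def speed_eq[OF D[OF t]] V_def ..
    finally show ?thesis .
  qed
  ultimately show ?thesis unfolding N_def[symmetric] by (rule has_integral_le)
qed

lemma distX_le:
  assumes "c \<in> curves x y" shows "distX B x y \<le> curve_length B c"
  unfolding distX_def
  by (rule cINF_lower) (use assms curve_length_nonneg in \<open>auto intro!: bdd_belowI2[of _ 0]\<close>)

lemma distX_nonneg:
  assumes "curves x y \<noteq> {}" shows "distX B x y \<ge> 0"
  unfolding distX_def by (rule cINF_greatest[OF assms curve_length_nonneg])

text \<open>By \<open>busemann_coset\<close> the ends of a curve may be replaced by the given
  representatives. The sign conditions on the weights make the constant positive, so that it can be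
  divided out before passing to the infimum.\<close>

lemma busemann_distX_bound:
  assumes "g \<in> SL3" "h \<in> SL3" "curves (act g basept) (act h basept) \<noteq> {}"
    "p \<noteq> 0" "q \<noteq> 0" "p \<bullet> q = 0" "0 < a \<or> 0 < b" "0 \<le> a" "0 \<le> b"
  shows "scal / 2 * (busemann a b p q h - busemann a b p q g)
    \<le> sqrt (2 * scal * (a\<^sup>2 + b\<^sup>2 + a * b) / 3) * distX B (act g basept) (act h basept)"
proof -
  define N where "N = sqrt (2 * scal * (a\<^sup>2 + b\<^sup>2 + a * b) / 3)"
  have "0 < a\<^sup>2 + b\<^sup>2 + a * b"
    using assms(7-9) mult_nonneg_nonneg[of a b]
    by (smt (verit) zero_le_power2 zero_less_power2)
  then have N: "N > 0" using scal_pos by (simp add: N_def)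
  have "scal / 2 * (busemann a b p q h - busemann a b p q g) / N \<le> distX B (act g basept) (act h basept)"
    unfolding distX_def
  proof (rule cINF_greatest[OF assms(3)])
    fix c assume c: "c \<in> curves (act g basept) (act h basept)"
    then have "c 0 \<in> SL3" "c 1 \<in> SL3" "act (c 0) basept = act g basept" "act (c 1) basept = act h basept"
      by (auto simp: curves_def)
    then have "busemann a b p q (c 0) = busemann a b p q g" "busemann a b p q (c 1) = busemann a b p q h"
      using busemann_coset assms by blast+
    then show "scal / 2 * (busemann a b p q h - busemann a b p q g) / N \<le> curve_length B c"
      using busemann_curve_bound[OF c assms(4-6), of a b, folded N_def] N
      by (simp add: pos_divide_le_eq mult_ac)
  qed
  then show ?thesis unfolding N_def[symmetric] using N by (simp add: field_simps)
qed

lemma curves_translate: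
  assumes g: "g \<in> SL3" and c: "c \<in> curves x y"
  shows "(\<lambda>t. g ** c t) \<in> curves (act g x) (act g y)"
    and "curve_length B (\<lambda>t. g ** c t) = curve_length B c"
proof -
  have c': "c C1_differentiable_on {0..1}" "\<And>t. t \<in> {0..1} \<Longrightarrow> c t \<in> SL3"
    "act (c 0) basept = x" "act (c 1) basept = y"
    using c by (auto simp: curves_def)
  show "(\<lambda>t. g ** c t) \<in> curves (act g x) (act g y)"
    using c' C1_matrix_mult[OF C1_matrix_const c'(1)] SL3_mult[OF g] act_act by (auto simp: curves_def)
  obtain D where D: "\<And>t. t \<in> {0..1} \<Longrightarrow> (c has_vector_derivative D t) (at t)"
    using c'(1) unfolding C1_differentiable_on_def by blast
  show "curve_length B (\<lambda>t. g ** c t) = curve_length B c"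
    unfolding curve_length_def
  proof (rule Henstock_Kurzweil_Integration.integral_cong)
    fix t :: real assume t: "t \<in> {0..1}"
    have "((\<lambda>t. g ** c t) has_vector_derivative g ** D t) (at t)"
      using matrix_deriv_mult[OF has_vector_derivative_const D[OF t]]
      by (simp add: bounded_bilinear.zero_left[OF bilinear_matrix_mult])
    moreover have "matrix_inv (g ** c t) ** (g ** D t) = matrix_inv (c t) ** D t"
      by (simp only: SL3_inv_mult[OF g c'(2)[OF t]] matrix_mul_assoc[symmetric] SL3_cancel_left[OF g])
    ultimately show "speed B (\<lambda>t. g ** c t) t = speed B c t"
      using D[OF t] by (simp add: speed_eq)
  qed
qed

lemma distX_translate:
  assumes g: "g \<in> SL3"
  shows "distX B (act g x) (act g y) = distX B x y"
proof -
  have im: "curve_length B ` curves x y \<subseteq> curve_length B ` curves (act g x) (act g y)"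
    if "g \<in> SL3" for g x y
    using curves_translate[OF that] by (smt (verit, ccfv_SIG) image_iff subsetI)
  have "act (matrix_inv g) (act g z) = z" for z
    by (simp add: act_act SL3_inv_left g act_one)
  then have "curve_length B ` curves (act g x) (act g y) = curve_length B ` curves x y"
    using im[OF g, of x y] im[OF SL3_inv[OF g], of "act g x" "act g y"] by auto
  then show ?thesis by (simp add: distX_def)
qed

lemma distX_exp_diag_le:
  assumes "x + y + z = 0"
  shows "distX B basept (act (exp_diag x y z) basept) \<le> sqrt (scal * (x\<^sup>2 + y\<^sup>2 + z\<^sup>2))"
proof -
  define c where "c = (\<lambda>t. exp_diag (0 + t * x) (0 + t * y) (0 + t * z))"
  have s: "0 + t * x + (0 + t * y) + (0 + t * z) = 0" for t
  proof -
    have "0 + t * x + (0 + t * y) + (0 + t * z) = t * (x + y + z)" by (simp add: algebra_simps)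
    then show ?thesis using assms by simp
  qed
  have c: "c \<in> curves basept (act (exp_diag x y z) basept)"
    unfolding curves_def c_def using exp_diag_C1[of 0 x 0 y 0 z] exp_diag_SL3[OF s]
    by (auto simp: exp_diag_zero act_one)
  have "speed B c t = sqrt (scal * (x\<^sup>2 + y\<^sup>2 + z\<^sup>2))" for t
  proof -
    have "matrix_inv (c t) ** (c t ** diag3 x y z) = diag3 x y z"
      by (rule SL3_cancel_left) (simp add: c_def exp_diag_SL3[OF s, simplified])
    moreover have "sym_part (diag3 x y z) = diag3 x y z"
      by (simp add: sym_part_def diag3_transpose scaleR_2[symmetric])
    moreover have "(c has_vector_derivative (c t ** diag3 x y z)) (at t)"
      unfolding c_def by (rule exp_diag_deriv)
    ultimately show ?thesis using speed_eq[of c "c t ** diag3 x y z" t] diag_norm[OF assms] by simp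
  qed
  then have "speed B c = (\<lambda>t. sqrt (scal * (x\<^sup>2 + y\<^sup>2 + z\<^sup>2)))" by blast
  then have "curve_length B c = sqrt (scal * (x\<^sup>2 + y\<^sup>2 + z\<^sup>2))"
    by (simp add: curve_length_def)
  then show ?thesis using distX_le[OF c] by simp
qed

end

section \<open>The isometry group of the form and its orbit of the base point\<close>

definition matJ :: "real^3^3" where
  "matJ = mat9 0 0 1 0 (-1) 0 1 0 0"

text \<open>This group has two components, but both have the orbit \<open>planeY\<close> of the base
  point. Points can therefore be compared here without any connectedness argument.\<close>

definition groupF :: "(real^3^3) set" where
  "groupF = {g \<in> SL3. transpose g ** matJ ** g = matJ}"

text \<open>\<open>matJ\<close> fixes this vector, and its images under \<open>groupF\<close> lie on
  the two-sheeted hyperboloid \<open>formF\<close> = 2. Taken up to sign, they give the hyperboloid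
  model of \<open>planeY\<close>.\<close>

definition vecu :: "real^3" where "vecu = vector [1, 0, 1]"

lemma formF_matJ: "formF v = v \<bullet> (matJ *v v)"
  by (rule vector3_cases[of v])
     (simp add: formF_def matJ_def mat9_simps inner_vector3 power2_eq_square)

lemma formF_eq_imp:
  assumes "transpose M = M" "\<And>v. v \<bullet> (M *v v) = formF v" shows "M = matJ"
proof -
  obtain a b c d e f g h i where M: "M = mat9 a b c d e f g h i" using mat9_eta by blast
  have s: "b = d \<and> c = g \<and> f = h"
    using assms(1) unfolding M mat9_transpose mat9_eq_iff by linarith
  have "x * (a*x+b*y+c*z) + y * (d*x+e*y+f*z) + z * (g*x+h*y+i*z) = 2 * x * z - y\<^sup>2" for x y z
    using assms(2)[of "vector [x, y, z]"] unfolding M mat9_mult_vec inner_vector3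
    by (simp add: formF_def)
  \<comment> \<open>The basis vectors and their pairwise sums determine the six entries of a
    symmetric matrix.\<close>
  from this[of 1 0 0] this[of 0 1 0] this[of 0 0 1] this[of 1 1 0] this[of 1 0 1] this[of 0 1 1] s
  show ?thesis unfolding M matJ_def mat9_eq_iff by simp
qed

lemma groupF_eq: "groupF = {g \<in> SL3. formF \<circ> (\<lambda>v. g *v v) = formF}"
proof -
  have inv: "v \<bullet> ((transpose g ** matJ ** g) *v v) = formF (g *v v)" for g :: "real^3^3" and v
    by (simp add: formF_matJ inner_matrix_transpose flip: matrix_vector_mul_assoc)
  have "transpose matJ = matJ" by (simp add: matJ_def mat9_transpose)
  then have "transpose (transpose g ** matJ ** g) = transpose g ** matJ ** g" for g :: "real^3^3"
    by (simp add: matrix_transpose_mul matrix_mul_assoc)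
  then have "transpose g ** matJ ** g = matJ \<longleftrightarrow> (\<forall>v. formF (g *v v) = formF v)" for g
    using formF_eq_imp[of "transpose g ** matJ ** g"] inv formF_matJ by metis
  then show ?thesis unfolding groupF_def by (auto simp: fun_eq_iff)
qed

lemma groupF_SL3: "g \<in> groupF \<Longrightarrow> g \<in> SL3"
  by (simp add: groupF_def)

lemma groupF_formF: "g \<in> groupF \<Longrightarrow> formF (g *v v) = formF v"
  unfolding groupF_eq by (auto simp: fun_eq_iff)

lemma groupF_mult:
  assumes "g \<in> groupF" "h \<in> groupF" shows "g ** h \<in> groupF"
  using assms unfolding groupF_eq by (auto simp: SL3_mult fun_eq_iff simp flip: matrix_vector_mul_assoc)

lemma groupF_inv:
  assumes "g \<in> groupF" shows "matrix_inv g \<in> groupF"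
proof -
  have "g *v (matrix_inv g *v v) = v" for v
    using assms by (simp add: matrix_vector_mul_assoc SL3_inv_right groupF_SL3)
  then have "formF (matrix_inv g *v v) = formF v" for v
    using groupF_formF[OF assms, of "matrix_inv g *v v"] by simp
  then show ?thesis using assms unfolding groupF_eq by (auto simp: SL3_inv fun_eq_iff)
qed

text \<open>The form has the matrix \<open>u u\<^sup>T - 1\<close>, so preserving it and \<open>\<plusminus>u\<close> means preserving the
  Euclidean inner product.\<close>

lemma groupF_stabiliser:
  assumes k: "k \<in> groupF" and u: "k *v vecu = vecu \<or> k *v vecu = - vecu"
  shows "k \<in> SO3"
proof -
  define U where "U = mat9 1 0 1 0 0 0 1 0 1"
  have U: "U *v v = (vecu \<bullet> v) *\<^sub>R vecu" for v
    by (rule vector3_cases[of v])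
       (simp add: U_def vecu_def mat9_simps inner_vector3, simp add: vec3_eq_iff)
  have one: "mat 1 = U - matJ" by (simp add: U_def matJ_def mat9_simps)
  have J: "transpose k ** matJ ** k = matJ" using k by (simp add: groupF_def)
  have Ju: "matJ *v vecu = vecu" by (simp add: matJ_def vecu_def mat9_simps)
  have k': "transpose k *v (matJ *v (k *v vecu)) = vecu"
    using J Ju by (simp add: matrix_vector_mul_assoc matrix_mul_assoc)
  have ku: "transpose k *v vecu = vecu \<or> transpose k *v vecu = - vecu"
    using u
  proof
    assume "k *v vecu = - vecu"
    then have "- (transpose k *v vecu) = vecu"
      using k' by (simp add: Ju bounded_bilinear.minus_right[OF bilinear_matrix_vector])
    then show ?thesis by (metis minus_minus)
  qed (use k' Ju in simp)
  have "transpose k ** U ** k = U"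
  proof (rule iffD2[OF matrix_eq], rule allI)
    fix v
    have "vecu \<bullet> (k *v v) = (transpose k *v vecu) \<bullet> v"
      by (simp add: inner_matrix_transpose)
    then show "(transpose k ** U ** k) *v v = U *v v"
      using ku by (auto simp: U matrix_vector_mult_scaleR simp flip: matrix_vector_mul_assoc)
  qed
  then have "transpose k ** (U - matJ) ** k = U - matJ"
    using J by (simp add: bounded_bilinear.diff_left[OF bilinear_matrix_mult]
        bounded_bilinear.diff_right[OF bilinear_matrix_mult])
  then show ?thesis using groupF_SL3[OF k] by (simp add: one[symmetric] SO3_iff SL3_def)
qed

lemma groupF_coset_eq:
  assumes g: "g \<in> groupF" and h: "h \<in> groupF"
    and u: "g *v vecu = h *v vecu \<or> g *v vecu = - (h *v vecu)"
  shows "act g basept = act h basept"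
proof -
  define k where "k = matrix_inv h ** g"
  have "k *v vecu = vecu \<or> k *v vecu = - vecu"
  proof -
    have "k *v vecu = matrix_inv h *v (g *v vecu)" by (simp add: k_def matrix_vector_mul_assoc)
    moreover have "matrix_inv h *v (h *v vecu) = vecu"
      by (simp add: matrix_vector_mul_assoc SL3_inv_left groupF_SL3[OF h])
    ultimately show ?thesis using u
      by (auto simp: bounded_bilinear.minus_right[OF bilinear_matrix_vector])
  qed
  then have "k \<in> SO3" by (intro groupF_stabiliser) (simp add: k_def groupF_mult groupF_inv g h)
  moreover have "g = h ** k" by (simp add: k_def SL3_cancel_right groupF_SL3 h)
  ultimately show ?thesis by (metis act_act act_SO3)
qed

section \<open>One-parameter subgroups and coordinates on the plane\<close>

definition hyp1 :: "real \<Rightarrow> real^3^3" where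
  "hyp1 s = exp_diag s 0 (- s)"

text \<open>The hyperbolic rotation of the span of (1,0,1) and (0,1,0) that fixes (-1,0,1). It is
  symmetric and its generator is orthogonal to that of \<open>hyp1\<close>, so it moves the base
  point along the geodesic of \<open>planeY\<close> perpendicular to A0 o.\<close>

definition hyp2 :: "real \<Rightarrow> real^3^3" where
  "hyp2 r = mat9 ((cosh r + 1) / 2) (sinh r / sqrt 2) ((cosh r - 1) / 2)
                 (sinh r / sqrt 2) (cosh r) (sinh r / sqrt 2)
                 ((cosh r - 1) / 2) (sinh r / sqrt 2) ((cosh r + 1) / 2)"

text \<open>The rotation by \<theta> about the axis \<open>vecu\<close>. It fixes the base point and
  turns the directions of \<open>planeY\<close> there.\<close>

definition rotu :: "real \<Rightarrow> real^3^3" where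
  "rotu \<theta> = mat9 ((1 + cos \<theta>) / 2) (- sin \<theta> / sqrt 2) ((1 - cos \<theta>) / 2)
                 (sin \<theta> / sqrt 2) (cos \<theta>) (- sin \<theta> / sqrt 2)
                 ((1 - cos \<theta>) / 2) (sin \<theta> / sqrt 2) ((1 + cos \<theta>) / 2)"

lemma hyp1_mat9: "hyp1 s = mat9 (exp s) 0 0 0 1 0 0 0 (exp (- s))"
  by (simp add: hyp1_def exp_diag_def diag3_mat9)

lemma hyp1_add: "hyp1 s ** hyp1 t = hyp1 (s + t)"
  by (simp add: hyp1_def exp_diag_mult)

lemma hyp1_zero: "hyp1 0 = mat 1" and hyp2_zero: "hyp2 0 = mat 1" and rotu_zero: "rotu 0 = mat 1"
  by (simp_all add: hyp1_mat9 hyp2_def rotu_def mat9_one)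

lemma hyp1_inv: "matrix_inv (hyp1 s) = hyp1 (- s)"
  by (simp add: hyp1_def exp_diag_inv)

lemma hyp1_transpose: "transpose (hyp1 s) = hyp1 s" and hyp2_transpose: "transpose (hyp2 r) = hyp2 r"
  by (simp_all add: hyp1_mat9 hyp2_def mat9_transpose)

lemma hyp2_inv: "matrix_inv (hyp2 r) = hyp2 (- r)"
proof (rule matrix_inv_unique_left)
  \<comment> \<open>Replacing the constants 1 / sqrt 2 and 1 / 2 by variables with relations 2 q q =
    1 and 2 w = 1 makes every entry a polynomial identity modulo these relations and the one between
    cosh and sinh.\<close>
  define q where "q = 1 / sqrt 2"
  have q: "2 * q * q = 1" "x / sqrt 2 = x * q" for x by (simp_all add: q_def)
  define w :: real where "w = 1 / 2"
  have w: "2 * w = 1" "x / 2 = x * w" for x by (simp_all add: w_def)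
  have c: "cosh r * cosh r = sinh r * sinh r + 1" using cosh_square_eq[of r] by (simp add: power2_eq_square)
  show "hyp2 (- r) ** hyp2 r = mat 1"
    unfolding hyp2_def q(2) w(2) mat9_mult mat9_one mat9_eq_iff cosh_minus sinh_minus
    by (intro conjI; use q(1) w(1) c in algebra)
qed

lemma hyp1_groupF: "hyp1 s \<in> groupF"
  by (simp add: groupF_def SL3_def hyp1_mat9 matJ_def mat9_simps flip: exp_add)

lemma hyp2_groupF: "hyp2 r \<in> groupF"
proof -
  define q where "q = 1 / sqrt 2"
  have q: "2 * q * q = 1" "x / sqrt 2 = x * q" for x by (simp_all add: q_def)
  define w :: real where "w = 1 / 2"
  have w: "2 * w = 1" "x / 2 = x * w" for x by (simp_all add: w_def)
  have c: "cosh r * cosh r = sinh r * sinh r + 1" using cosh_square_eq[of r] by (simp add: power2_eq_square)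
  have "det (hyp2 r) = 1"
    unfolding hyp2_def q(2) w(2) mat9_det using q(1) w(1) c by algebra
  moreover have "transpose (hyp2 r) ** matJ ** hyp2 r = matJ"
    unfolding hyp2_def q(2) w(2) matJ_def mat9_mult mat9_transpose mat9_eq_iff
    by (intro conjI; use q(1) w(1) c in algebra)
  ultimately show ?thesis by (simp add: groupF_def SL3_def)
qed

lemma rotu_groupF: "rotu \<theta> \<in> groupF"
proof -
  define q where "q = 1 / sqrt 2"
  have q: "2 * q * q = 1" "x / sqrt 2 = x * q" for x by (simp_all add: q_def)
  define w :: real where "w = 1 / 2"
  have w: "2 * w = 1" "x / 2 = x * w" for x by (simp_all add: w_def)
  have c: "cos \<theta> * cos \<theta> + sin \<theta> * sin \<theta> = 1"
    using sin_cos_squared_add2[of \<theta>] by (simp add: power2_eq_square)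
  have "det (rotu \<theta>) = 1"
    unfolding rotu_def q(2) w(2) mat9_det using q(1) w(1) c by algebra
  moreover have "transpose (rotu \<theta>) ** matJ ** rotu \<theta> = matJ"
    unfolding rotu_def q(2) w(2) matJ_def mat9_mult mat9_transpose mat9_eq_iff
    by (intro conjI; use q(1) w(1) c in algebra)
  ultimately show ?thesis by (simp add: groupF_def SL3_def)
qed

lemma rotu_vecu: "rotu \<theta> *v vecu = vecu"
  by (simp add: rotu_def vecu_def mat9_simps field_simps)

lemma rotu_SO3: "rotu \<theta> \<in> SO3"
  using groupF_stabiliser[OF rotu_groupF] rotu_vecu by blast

lemma fermi_vecu: "(hyp1 s ** hyp2 r) *v vecu = vector [exp s * cosh r, sqrt 2 * sinh r, exp (-s) * cosh r]"
proof -
  have "sinh r / sqrt 2 + sinh r / sqrt 2 = sqrt 2 * sinh r"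
    by (simp add: field_simps)
  then show ?thesis
    by (simp add: hyp1_mat9 hyp2_def vecu_def mat9_mult_vec flip: matrix_vector_mul_assoc add_divide_distrib)
qed

lemma polar_vecu: "(rotu \<theta> ** hyp1 s) *v vecu =
  vector [cosh s + cos \<theta> * sinh s, sqrt 2 * (sin \<theta> * sinh s), cosh s - cos \<theta> * sinh s]"
proof -
  have "sin \<theta> / sqrt 2 * exp s + - sin \<theta> / sqrt 2 * exp (-s) = sqrt 2 * (sin \<theta> * sinh s)"
    unfolding sinh_def by (simp add: field_simps)
  moreover have "(1 + cos \<theta>) / 2 * exp s + (1 - cos \<theta>) / 2 * exp (-s) = cosh s + cos \<theta> * sinh s"
    "(1 - cos \<theta>) / 2 * exp s + (1 + cos \<theta>) / 2 * exp (-s) = cosh s - cos \<theta> * sinh s"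
    unfolding sinh_def cosh_def by (simp_all add: field_simps)
  ultimately show ?thesis
    by (simp add: hyp1_mat9 rotu_def vecu_def mat9_mult_vec vector3_eq_iff flip: matrix_vector_mul_assoc)
qed

lemma groupF_orbit:
  assumes "g \<in> groupF"
  obtains x y z where "2 * x * z = 2 + y\<^sup>2" "x > 0" "z > 0"
    "g *v vecu = vector [x, y, z] \<or> g *v vecu = - vector [x, y, z]"
proof -
  obtain x y z where w: "g *v vecu = vector [x, y, z]" using vector3_cases by blast
  have "formF (g *v vecu) = 2" using groupF_formF[OF assms] by (simp add: formF_def vecu_def)
  then have xz: "2 * x * z = 2 + y\<^sup>2" by (simp add: w formF_def)
  then have "x * z > 0" using zero_le_power2[of y] by linarith
  then consider "x > 0" "z > 0" | "x < 0" "z < 0" by (auto simp: zero_less_mult_iff)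
  then show ?thesis
  proof cases
    case 1 then show ?thesis using that xz w by blast
  next
    case 2
    have "g *v vecu = - vector [-x, -y, -z]" by (simp add: w vec3_eq_iff)
    then show ?thesis using that[of "-x" "-z" "-y"] xz 2 by simp
  qed
qed

lemma fermi_coordinates:
  assumes g: "g \<in> groupF" obtains s r where "act g basept = act (hyp1 s ** hyp2 r) basept"
proof -
  obtain x y z where w: "2 * x * z = 2 + y\<^sup>2" "x > 0" "z > 0"
    "g *v vecu = vector [x, y, z] \<or> g *v vecu = - vector [x, y, z]"
    using groupF_orbit[OF g] by blast
  define r where "r = arsinh (y / sqrt 2)"
  define s where "s = ln (x / cosh r)"
  have y: "sqrt 2 * sinh r = y" by (simp add: r_def)
  have C: "cosh r * cosh r = x * z"
    using cosh_square_eq[of r] w(1) by (simp add: power2_eq_square r_def field_simps)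
  have c: "cosh r > 0" by simp
  have s: "exp s = x / cosh r" using w(2) c by (simp add: s_def)
  have "exp s * cosh r = x" using c by (simp add: s)
  moreover have "exp (- s) * cosh r = z"
    using C w(2) c by (simp add: exp_minus s field_simps)
  ultimately have "(hyp1 s ** hyp2 r) *v vecu = vector [x, y, z]"
    by (simp add: fermi_vecu y)
  then have "act g basept = act (hyp1 s ** hyp2 r) basept"
    using w(4) by (intro groupF_coset_eq g groupF_mult hyp1_groupF hyp2_groupF) simp
  then show ?thesis using that by blast
qed

lemma polar_coordinates:
  assumes g: "g \<in> groupF" obtains \<theta> s where "s \<ge> 0" "act g basept = act (rotu \<theta> ** hyp1 s) basept"
proof -
  obtain x y z where w: "2 * x * z = 2 + y\<^sup>2" "x > 0" "z > 0"
    "g *v vecu = vector [x, y, z] \<or> g *v vecu = - vector [x, y, z]"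
    using groupF_orbit[OF g] by blast
  \<comment> \<open>By \<open>polar_vecu\<close> the first and third coordinates add up to 2 cosh s,
    and half their difference is the first polar component.\<close>
  define A where "A = (x + z) / 2"
  define D where "D = (x - z) / 2"
  have AD: "A\<^sup>2 - 1 = D\<^sup>2 + (y / sqrt 2)\<^sup>2"
    using w(1) by (simp add: A_def D_def power2_eq_square field_simps)
  then have "1\<^sup>2 \<le> A\<^sup>2" by (smt (verit) one_power2 sum_power2_ge_zero)
  then have A: "1 \<le> A" by (rule power2_le_imp_le) (use w in \<open>simp add: A_def\<close>)
  define s where "s = arcosh A"
  have s: "s \<ge> 0" "cosh s = A" using A by (simp_all add: s_def)
  have sh: "(sinh s)\<^sup>2 = D\<^sup>2 + (y / sqrt 2)\<^sup>2"
    using sinh_square_eq[of s] AD s by simp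
  obtain \<theta> where th: "cos \<theta> * sinh s = D" "sin \<theta> * sinh s = y / sqrt 2"
  proof (cases "sinh s = 0")
    case True
    then have "D = 0 \<and> y / sqrt 2 = 0" using sh by (metis power_zero_numeral sum_power2_eq_zero_iff)
    then show ?thesis using that[of 0] True by simp
  next
    case False
    then have "(D / sinh s)\<^sup>2 + (y / sqrt 2 / sinh s)\<^sup>2 = 1"
      unfolding power_divide[of _ "sinh s"] add_divide_distrib[symmetric] sh[symmetric]
      using False by simp
    then obtain \<theta> where "D / sinh s = cos \<theta>" "y / sqrt 2 / sinh s = sin \<theta>"
      using sincos_total_2pi by metis
    then show ?thesis using that[of \<theta>] False by (simp add: field_simps)
  qed
  have "(rotu \<theta> ** hyp1 s) *v vecu = vector [x, y, z]"
    unfolding polar_vecu th s(2) by (simp add: A_def D_def vector3_eq_iff field_simps)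
  then have "act g basept = act (rotu \<theta> ** hyp1 s) basept"
    using w(4) by (intro groupF_coset_eq g groupF_mult hyp1_groupF rotu_groupF) simp
  then show ?thesis using that s(1) by blast
qed

lemma hyp2_coset: "act (hyp2 r) basept = act (rotu (pi/2) ** hyp1 r) basept"
proof (rule groupF_coset_eq)
  show "hyp2 r *v vecu = (rotu (pi/2) ** hyp1 r) *v vecu \<or> hyp2 r *v vecu = - ((rotu (pi/2) ** hyp1 r) *v vecu)"
    using fermi_vecu[of 0 r] by (simp add: polar_vecu hyp1_zero)
qed (intro hyp2_groupF groupF_mult rotu_groupF hyp1_groupF)+

section \<open>The identity component as a group\<close>

lemma groupH_eq: "groupH = connected_component_set groupF (mat 1)"
  by (simp add: groupH_def groupF_eq)

lemma groupH_groupF: "h \<in> groupH \<Longrightarrow> h \<in> groupF"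
  unfolding groupH_eq using connected_component_subset by blast

lemma groupF_one: "mat 1 \<in> groupF"
  using hyp1_groupF[of 0] by (simp add: hyp1_zero)

text \<open>Left translation carries connected sets to connected sets, so h can be joined to the
  identity after multiplication by g if g can. Allowing the inverse of g in place of g yields
  closure under products and under inverses from one argument.\<close>

lemma groupH_translate:
  assumes g: "g \<in> groupF" "g \<in> groupH \<or> matrix_inv g \<in> groupH" and h: "h \<in> groupH"
  shows "g ** h \<in> groupH"
proof -
  have tr: "connected_component groupF (a ** x) (a ** y)"
    if xy: "connected_component groupF x y" and a: "a \<in> groupF" for a x y
  proof -
    obtain T where T: "connected T" "T \<subseteq> groupF" "x \<in> T" "y \<in> T"
      using xy unfolding connected_component_def by blast
    have "connected ((**) a ` T)"
      by (intro connected_continuous_image matrix_cont_mult continuous_on_const continuous_on_id T)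
    moreover have "(**) a ` T \<subseteq> groupF" using T a groupF_mult by blast
    ultimately show ?thesis unfolding connected_component_def using T by blast
  qed
  have gh: "connected_component groupF g (g ** h)"
    using tr[of "mat 1" h g] h g by (simp add: groupH_eq)
  have "connected_component groupF (mat 1) g"
    using g(2)
  proof
    assume "matrix_inv g \<in> groupH"
    then have "connected_component groupF (g ** mat 1) (g ** matrix_inv g)"
      using tr g(1) by (simp add: groupH_eq del: matrix_mul_rid)
    then show ?thesis using g(1) connected_component_sym by (simp add: SL3_inv_right groupF_SL3)
  qed (simp add: groupH_eq)
  with gh show ?thesis unfolding groupH_eq using connected_component_trans by blast
qed

lemma groupH_mult: "g \<in> groupH \<Longrightarrow> h \<in> groupH \<Longrightarrow> g ** h \<in> groupH"
  using groupH_translate groupH_groupF by blast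

lemma groupH_one: "mat 1 \<in> groupH"
  unfolding groupH_eq using groupF_one by simp

lemma matrix_inv_inv: "g \<in> SL3 \<Longrightarrow> matrix_inv (matrix_inv g) = g"
  by (rule matrix_inv_unique_left[OF SL3_inv_right])

lemma groupH_inv:
  assumes "g \<in> groupH" shows "matrix_inv g \<in> groupH"
  using groupH_translate[OF groupF_inv[OF groupH_groupF[OF assms]] _ groupH_one] assms
  by (simp add: matrix_inv_inv groupF_SL3 groupH_groupF)

lemma groupH_SL3: "h \<in> groupH \<Longrightarrow> h \<in> SL3"
  using groupH_groupF groupF_SL3 by blast

lemma groupH_path:
  assumes "continuous_on UNIV f" "\<And>s::real. f s \<in> groupF" "f 0 = mat 1"
  shows "f s \<in> groupH"
proof -
  have "connected (range f)" by (intro connected_continuous_image assms(1)) simp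
  moreover have "mat 1 \<in> range f" using assms(3) by (metis rangeI)
  ultimately have "connected_component groupF (mat 1) (f s)"
    unfolding connected_component_def using assms(2) by blast
  then show ?thesis by (simp add: groupH_eq)
qed

lemma continuous_mat9:
  fixes a :: "real \<Rightarrow> real"
  assumes "continuous_on S a" "continuous_on S b" "continuous_on S c" "continuous_on S d"
    "continuous_on S e" "continuous_on S f" "continuous_on S g" "continuous_on S h" "continuous_on S i"
  shows "continuous_on S (\<lambda>t. mat9 (a t) (b t) (c t) (d t) (e t) (f t) (g t) (h t) (i t))"
proof -
  have dec: "mat9 a b c d e f g h i = a *\<^sub>R mat9 1 0 0 0 0 0 0 0 0 + b *\<^sub>R mat9 0 1 0 0 0 0 0 0 0
    + c *\<^sub>R mat9 0 0 1 0 0 0 0 0 0 + d *\<^sub>R mat9 0 0 0 1 0 0 0 0 0 + e *\<^sub>R mat9 0 0 0 0 1 0 0 0 0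
    + f *\<^sub>R mat9 0 0 0 0 0 1 0 0 0 + g *\<^sub>R mat9 0 0 0 0 0 0 1 0 0 + h *\<^sub>R mat9 0 0 0 0 0 0 0 1 0
    + i *\<^sub>R mat9 0 0 0 0 0 0 0 0 1" for a b c d e f g h i
    by (simp add: mat9_simps)
  show ?thesis
    by (rule continuous_on_eq[OF _ dec[symmetric]]) (intro continuous_intros assms)
qed

lemma hyp1_groupH: "hyp1 s \<in> groupH"
proof (rule groupH_path)
  show "continuous_on UNIV hyp1" unfolding hyp1_mat9 by (intro continuous_mat9 continuous_intros)
qed (rule hyp1_groupF hyp1_zero)+

lemma hyp2_groupH: "hyp2 r \<in> groupH"
proof (rule groupH_path)
  show "continuous_on UNIV hyp2" unfolding hyp2_def by (intro continuous_mat9 continuous_intros) auto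
qed (rule hyp2_groupF hyp2_zero)+

lemma rotu_groupH: "rotu \<theta> \<in> groupH"
proof (rule groupH_path)
  show "continuous_on UNIV rotu" unfolding rotu_def by (intro continuous_mat9 continuous_intros) auto
qed (rule rotu_groupF rotu_zero)+

lemma planeY_eq: "planeY = {act (hyp1 s ** hyp2 r) basept | s r. True}"
  unfolding planeY_def
  using fermi_coordinates[OF groupH_groupF] groupH_mult[OF hyp1_groupH hyp2_groupH]
  by (auto simp: image_iff) metis+

lemma planeY_act: "h \<in> groupH \<Longrightarrow> y \<in> planeY \<Longrightarrow> act h y \<in> planeY"
  unfolding planeY_def using groupH_mult by (auto simp: act_act)

section \<open>Nearest point projection\<close>

text \<open>Its columns are the unit vectors along (1,0,1), (0,1,0), (-1,0,1), an eigenbasis of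
  \<open>matJ\<close>. Symmetric matrices that are diagonal in it commute with \<open>matJ\<close>,
  whereas tangent vectors of \<open>planeY\<close> at the base point anticommute with it; so the
  former are normal to \<open>planeY\<close>.\<close>

definition basisu :: "real^3^3" where
  "basisu = mat9 (1 / sqrt 2) 0 (- 1 / sqrt 2) 0 1 0 (1 / sqrt 2) 0 (1 / sqrt 2)"

lemma basisu_SO3: "basisu \<in> SO3"
  by (simp add: basisu_def SO3_iff mat9_simps)

lemma vec3_axis:
  "axis 1 1 = (vector [1, 0, 0] :: real^3)" "axis 2 1 = (vector [0, 1, 0] :: real^3)"
  "axis 3 1 = (vector [0, 0, 1] :: real^3)"
  by (simp_all add: vec3_eq_iff axis_def)

lemma exp_diag_axis: "exp_diag (m$1) (m$2) (m$3) *v axis i 1 = exp (m$i) *\<^sub>R axis i 1"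
proof -
  consider "i = 1" | "i = 2" | "i = 3" using exhaust_3 by blast
  then show ?thesis
    by cases (simp_all add: vec3_axis exp_diag_def diag3_mat9 mat9_simps, simp_all add: vec3_eq_iff)
qed

text \<open>On the flat spanned by the eigenlines k e_1, k e_2, k e_3 the Busemann function is
  linear in the exponents, which gives its exact value at the far point in
  \<open>distX_lower\<close>.\<close>

lemma busemann_rotated:
  assumes k: "k \<in> SO3" and m: "m$1 + m$2 + m$3 = 0"
  shows "busemann a b (k *v axis i 1) (k *v axis j 1) (k ** exp_diag (m$1) (m$2) (m$3)) = 2 * b * m$i - 2 * a * m$j"
proof -
  let ?M = "exp_diag (m$1) (m$2) (m$3)"
  have "transpose (k ** ?M) *v (k *v axis i 1) = ?M *v ((transpose k ** k) *v axis i 1)"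
    by (simp only: matrix_transpose_mul exp_diag_transpose matrix_vector_mul_assoc matrix_mul_assoc)
  also have "\<dots> = exp (m$i) *\<^sub>R axis i 1" using k by (simp add: SO3_iff exp_diag_axis)
  finally have 1: "transpose (k ** ?M) *v (k *v axis i 1) = exp (m$i) *\<^sub>R axis i 1" .
  have "matrix_inv (k ** ?M) = exp_diag ((- m)$1) ((- m)$2) ((- m)$3) ** transpose k"
    by (simp add: SL3_inv_mult SO3_SL3 k exp_diag_SL3 m exp_diag_inv SO3_inv)
  then have "matrix_inv (k ** ?M) *v (k *v axis j 1)
      = exp_diag ((- m)$1) ((- m)$2) ((- m)$3) *v ((transpose k ** k) *v axis j 1)"
    by (simp only: matrix_vector_mul_assoc matrix_mul_assoc)
  also have "\<dots> = exp ((- m)$j) *\<^sub>R axis j 1"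
    using k unfolding exp_diag_axis[of "- m", symmetric] by (simp add: SO3_iff)
  finally have 2: "matrix_inv (k ** ?M) *v (k *v axis j 1) = exp (- m$j) *\<^sub>R axis j 1" by simp
  show ?thesis unfolding busemann_def 1 2
    by (simp add: ln_mult)
qed

lemma fermi_norms:
  defines "g s r \<equiv> transpose (hyp1 s ** hyp2 r)" and "Q r \<equiv> (cosh r)\<^sup>2 + (sinh r)\<^sup>2"
  shows "(g s r *v (basisu *v axis 2 1)) \<bullet> (g s r *v (basisu *v axis 2 1)) = Q r"
    "(g s r *v (basisu *v axis 1 1)) \<bullet> (g s r *v (basisu *v axis 1 1)) = Q r * (cosh s)\<^sup>2 + (sinh s)\<^sup>2"
proof -
  have g: "g s r *v x = hyp2 r *v (hyp1 s *v x)" for x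
    by (simp add: g_def matrix_transpose_mul hyp1_transpose hyp2_transpose matrix_vector_mul_assoc)
  have b: "basisu *v axis 2 1 = vector [0, 1, 0]" "basisu *v axis 1 1 = vector [1 / sqrt 2, 0, 1 / sqrt 2]"
    by (simp_all add: basisu_def vec3_axis mat9_mult_vec)
  show "(g s r *v (basisu *v axis 2 1)) \<bullet> (g s r *v (basisu *v axis 2 1)) = Q r"
    by (simp add: g b hyp1_mat9 hyp2_def mat9_mult_vec inner_vector3 Q_def power2_eq_square)
  define q where "q = 1 / sqrt 2"
  have q: "2 * q * q = 1" "x / sqrt 2 = x * q" for x by (simp_all add: q_def)
  define w :: real where "w = 1 / 2"
  have w: "2 * w = 1" "x / 2 = x * w" for x by (simp_all add: w_def)
  have e: "exp s = cosh s + sinh s" "exp (- s) = cosh s - sinh s"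
    by (simp_all add: cosh_plus_sinh cosh_minus_sinh)
  show "(g s r *v (basisu *v axis 1 1)) \<bullet> (g s r *v (basisu *v axis 1 1)) = Q r * (cosh s)\<^sup>2 + (sinh s)\<^sup>2"
    unfolding g b hyp1_mat9 hyp2_def mat9_mult_vec inner_vector3 Q_def q(2) w(2) e
    using q(1) w(1) by algebra
qed

text \<open>The inverse of \<open>hyp1 s ** hyp2 r\<close> is its transpose with both signs flipped,
  and the norms in \<open>fermi_norms\<close> are even in s and r. Hence exchanging the two vectors
  only exchanges the weights.\<close>

lemma fermi_busemann:
  defines "Q r \<equiv> (cosh r)\<^sup>2 + (sinh r)\<^sup>2"
  shows "busemann a b (basisu *v axis 2 1) (basisu *v axis 1 1) (hyp1 s ** hyp2 r)
      = b * ln (Q r) + a * ln (Q r * (cosh s)\<^sup>2 + (sinh s)\<^sup>2)"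
    and "busemann a b (basisu *v axis 1 1) (basisu *v axis 2 1) (hyp1 s ** hyp2 r)
      = b * ln (Q r * (cosh s)\<^sup>2 + (sinh s)\<^sup>2) + a * ln (Q r)"
proof -
  have "matrix_inv (hyp1 s ** hyp2 r) = transpose (hyp1 (-s) ** hyp2 (-r))"
    by (simp add: SL3_inv_mult groupF_SL3 hyp1_groupF hyp2_groupF hyp1_inv hyp2_inv
        matrix_transpose_mul hyp1_transpose hyp2_transpose)
  note i = this fermi_norms[of s r] fermi_norms[of "-s" "-r"]
  show "busemann a b (basisu *v axis 2 1) (basisu *v axis 1 1) (hyp1 s ** hyp2 r)
      = b * ln (Q r) + a * ln (Q r * (cosh s)\<^sup>2 + (sinh s)\<^sup>2)"
    "busemann a b (basisu *v axis 1 1) (basisu *v axis 2 1) (hyp1 s ** hyp2 r)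
      = b * ln (Q r * (cosh s)\<^sup>2 + (sinh s)\<^sup>2) + a * ln (Q r)"
    unfolding busemann_def i Q_def by simp_all
qed

section \<open>Lower bounds, exact distances and the nearest point\<close>

context invariant_inner
begin

text \<open>Here i, l, j index the smallest, middle and largest exponent. With these weights the
  Lipschitz constant is the length of m, and the Busemann function is -2 S at the far point. At the
  base point it vanishes, so there the bound reads length squared at most length times
  distance.\<close>

lemma distX_lower:
  fixes m :: "real^3"
  assumes k: "k \<in> SO3" and m: "m$1 + m$2 + m$3 = 0"
    and ijl: "i \<noteq> j" "i \<noteq> l" "j \<noteq> l" and ord: "m$i \<le> m$l" "m$l \<le> m$j" "m$i < m$j"
    and h: "h \<in> SL3"
    and ne: "curves (act (k ** exp_diag (m$1) (m$2) (m$3)) basept) (act h basept) \<noteq> {}"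
  defines "S \<equiv> (m$1)\<^sup>2 + (m$2)\<^sup>2 + (m$3)\<^sup>2"
  shows "scal * S + scal / 2 * busemann (m$j - m$l) (m$l - m$i) (k *v axis i 1) (k *v axis j 1) h
    \<le> sqrt (scal * S) * distX B (act (k ** exp_diag (m$1) (m$2) (m$3)) basept) (act h basept)"
proof -
  define a where "a = m$j - m$l"
  define b where "b = m$l - m$i"
  have U: "{i, j, l} = (UNIV :: 3 set)"
    by (rule card_subset_eq) (use ijl in simp_all)
  have sums: "f i + f j + f l = f 1 + f 2 + f 3" for f :: "3 \<Rightarrow> real"
  proof -
    have "sum f UNIV = f i + f j + f l" unfolding U[symmetric] using ijl by simp
    then show ?thesis by (simp add: sum_3)
  qed
  have 0: "m$i + m$j + m$l = 0" using sums[of "\<lambda>i. m$i"] m by simp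
  have S: "S = (m$i)\<^sup>2 + (m$j)\<^sup>2 + (m$l)\<^sup>2" using sums[of "\<lambda>i. (m$i)\<^sup>2"] by (simp add: S_def)
  have l: "m$l = - m$i - m$j" using 0 by linarith
  have ab: "2 * scal * (a\<^sup>2 + b\<^sup>2 + a * b) / 3 = scal * S"
    unfolding S a_def b_def l by (simp add: power2_eq_square algebra_simps)
  have kS: "k ** exp_diag (m$1) (m$2) (m$3) \<in> SL3"
    by (intro SL3_mult SO3_SL3 k exp_diag_SL3 m)
  have ax: "norm (k *v axis n 1) = 1" for n by (simp add: norm_SO3_mult k)
  have orth: "(k *v axis i 1) \<bullet> (k *v axis j 1) = 0"
    using k ijl by (simp add: inner_matrix_transpose matrix_vector_mul_assoc SO3_iff inner_axis_axis)
  have "k *v axis n 1 \<noteq> 0" for n using ax[of n] by auto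
  then have nz: "k *v axis i 1 \<noteq> 0" "k *v axis j 1 \<noteq> 0" by blast+
  have pos: "0 < a \<or> 0 < b" "0 \<le> a" "0 \<le> b" using ord by (auto simp: a_def b_def)
  have e: "2 * b * m$i - 2 * a * m$j = - 2 * S"
    unfolding S a_def b_def l by (simp add: power2_eq_square algebra_simps)
  show ?thesis
    using busemann_distX_bound[OF kS h ne nz orth pos]
    unfolding ab busemann_rotated[OF k m] e a_def[symmetric] b_def[symmetric]
    by (simp add: algebra_simps)
qed

lemma distX_exp_diag_ge:
  assumes "x + y + z = 0"
  shows "sqrt (scal * (x\<^sup>2 + y\<^sup>2 + z\<^sup>2)) \<le> distX B basept (act (exp_diag x y z) basept)"
proof -
  \<comment> \<open>Translation by the inverse matrix turns the base point into the target, where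
    the Busemann function vanishes; hence the signs.\<close>
  define m :: "real^3" where "m = vector [-x, -y, -z]"
  have m: "m$1 = -x" "m$2 = -y" "m$3 = -z" by (simp_all add: m_def)
  have m0: "m$1 + m$2 + m$3 = 0" using assms by (simp add: m)
  let ?M = "exp_diag (-x) (-y) (-z)"
  have tr: "distX B (act ?M basept) basept = distX B basept (act (exp_diag x y z) basept)"
    using distX_translate[OF exp_diag_SL3[of "-x" "-y" "-z"], of basept "act (exp_diag x y z) basept"] assms
    by (simp add: act_act exp_diag_mult exp_diag_zero act_one)
  have ne: "curves (act (mat 1 ** ?M) basept) (act (mat 1) basept) \<noteq> {}"
    using curves_nonempty[OF SO3_one SO3_one, of "-x" "-y" "-z" 0 0 0] assms
    by (simp add: exp_diag_zero)
  have ge: ?thesis if "i \<noteq> j" "i \<noteq> l" "j \<noteq> l" "m$i \<le> m$l" "m$l \<le> m$j" "m$i < m$j" for i j l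
  proof -
    define X where "X = scal * (x\<^sup>2 + y\<^sup>2 + z\<^sup>2)"
    have "m \<noteq> 0" using that by auto
    then have "x \<noteq> 0 \<or> y \<noteq> 0 \<or> z \<noteq> 0" by (auto simp: vec3_eq_iff m)
    then have "X > 0" unfolding X_def using scal_pos
      by (smt (verit) mult_pos_pos zero_le_power2 zero_less_power2)
    have "matrix_inv (mat 1) = (mat 1 :: real^3^3)" by (rule matrix_inv_unique_left) simp
    then have "busemann a b (mat 1 *v axis i 1) (mat 1 *v axis j 1) (mat 1) = 0" for a b
      by (simp add: busemann_def inner_axis_axis)
    then have "X \<le> sqrt X * distX B basept (act (exp_diag x y z) basept)"
      using distX_lower[OF SO3_one m0 that SL3_one] ne by (simp add: m tr act_one X_def)
    then have "sqrt X * sqrt X \<le> sqrt X * distX B basept (act (exp_diag x y z) basept)"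
      using \<open>X > 0\<close> by simp
    then show ?thesis using \<open>X > 0\<close> unfolding X_def[symmetric]
      using mult_le_cancel_left_pos real_sqrt_gt_zero by blast
  qed
  show ?thesis
  proof (cases "x = y \<and> y = z")
    case True
    then have "x = 0" "y = 0" "z = 0" using assms by auto
    then show ?thesis
      using distX_nonneg[OF ne] tr by (simp add: exp_diag_zero act_one)
  next
    case False
    then consider "m$1 \<le> m$2" "m$2 \<le> m$3" "m$1 < m$3" | "m$1 \<le> m$3" "m$3 \<le> m$2" "m$1 < m$2"
      | "m$2 \<le> m$1" "m$1 \<le> m$3" "m$2 < m$3" | "m$2 \<le> m$3" "m$3 \<le> m$1" "m$2 < m$1"
      | "m$3 \<le> m$1" "m$1 \<le> m$2" "m$3 < m$2" | "m$3 \<le> m$2" "m$2 \<le> m$1" "m$3 < m$1"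
      unfolding m by linarith
    then show ?thesis
      by cases (rule ge[of 1 3 2] ge[of 1 2 3] ge[of 2 3 1] ge[of 2 1 3] ge[of 3 2 1] ge[of 3 1 2]; simp)+
  qed
qed

lemma distX_exp_diag:
  assumes "x + y + z = 0"
  shows "distX B basept (act (exp_diag x y z) basept) = sqrt (scal * (x\<^sup>2 + y\<^sup>2 + z\<^sup>2))"
  using distX_exp_diag_le[OF assms] distX_exp_diag_ge[OF assms] by simp

lemma distX_hyp1: "distX B basept (act (hyp1 s) basept) = sqrt (2 * scal) * \<bar>s\<bar>"
  unfolding hyp1_def by (subst distX_exp_diag) (simp_all add: real_sqrt_mult algebra_simps flip: power2_eq_square)

lemma distX_rotu: "distX B basept (act (rotu \<theta> ** g) basept) = distX B basept (act g basept)"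
  using distX_translate[OF SO3_SL3[OF rotu_SO3], of \<theta> basept "act g basept"]
  by (simp add: act_act act_SO3 rotu_SO3)

lemma distX_hyp2: "distX B basept (act (hyp2 r) basept) = sqrt (2 * scal) * \<bar>r\<bar>"
  by (simp add: hyp2_coset distX_rotu distX_hyp1)

text \<open>The Busemann function adapted to the geodesic from \<open>p\<close> through \<open>basept\<close> attains its minimum over
  \<open>planeY\<close> at \<open>basept\<close>. It does so only there unless \<open>x = z\<close>, when \<open>p\<close> lies in the diagonal flat and
  the points of \<open>A0\<close> have to be excluded by a direct computation.\<close>

lemma nearest_basept:
  fixes r s x y z :: real
  assumes xyz: "x + y + z = 0" and ord: "y < z \<and> z \<le> x \<or> x \<le> z \<and> z < y"
  defines "p \<equiv> act (basisu ** exp_diag x y z) basept" and "q \<equiv> act (hyp1 s ** hyp2 r) basept"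
  shows "distX B p basept \<le> distX B p q" and "distX B p q \<le> distX B p basept \<Longrightarrow> q = basept"
proof -
  define d where "d = sqrt (scal * (x\<^sup>2 + y\<^sup>2 + z\<^sup>2))"
  have "x \<noteq> 0 \<or> y \<noteq> 0 \<or> z \<noteq> 0" using ord by auto
  then have "x\<^sup>2 + y\<^sup>2 + z\<^sup>2 > 0" by (smt (verit) zero_le_power2 zero_less_power2)
  then have d: "d > 0" "d * d = scal * (x\<^sup>2 + y\<^sup>2 + z\<^sup>2)" using scal_pos by (auto simp: d_def)
  have xyz': "(-x) + (-y) + (-z) = 0" using xyz by simp
  have "exp_diag (-x) (-y) (-z) ** transpose basisu ** (basisu ** exp_diag x y z) = mat 1"
  proof -
    have "exp_diag (-x) (-y) (-z) ** transpose basisu ** (basisu ** exp_diag x y z)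
      = exp_diag (-x) (-y) (-z) ** (transpose basisu ** basisu) ** exp_diag x y z"
      by (simp only: matrix_mul_assoc)
    then show ?thesis using basisu_SO3 by (simp add: SO3_iff exp_diag_mult exp_diag_zero)
  qed
  moreover have "exp_diag (-x) (-y) (-z) ** transpose basisu \<in> SL3"
    by (intro SL3_mult exp_diag_SL3 xyz' SL3_transpose SO3_SL3 basisu_SO3)
  ultimately have dp: "distX B p basept = d"
    using distX_translate[of "exp_diag (-x) (-y) (-z) ** transpose basisu" p basept]
    by (simp add: p_def act_act act_one distX_exp_diag[OF xyz'] d_def act_SO3 SO3_transpose basisu_SO3
        flip: act_act[of _ "transpose basisu" basept])
  define m :: "real^3" where "m = vector [x, y, z]"
  have m: "m$1 = x" "m$2 = y" "m$3 = z" by (simp_all add: m_def)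
  have h: "hyp1 s ** hyp2 r \<in> groupF" by (intro groupF_mult hyp1_groupF hyp2_groupF)
  \<comment> \<open>\<open>curves_nonempty\<close> asks for a rotation times a diagonal matrix,
    which polar coordinates provide.\<close>
  obtain \<theta> \<sigma> where "q = act (rotu \<theta> ** hyp1 \<sigma>) basept"
    using polar_coordinates[OF h] unfolding q_def by metis
  then have ne: "curves p q \<noteq> {}"
    unfolding p_def hyp1_def by (simp add: curves_nonempty basisu_SO3 rotu_SO3 xyz)
  define Q where "Q = (cosh r)\<^sup>2 + (sinh r)\<^sup>2"
  define P where "P = Q * (cosh s)\<^sup>2 + (sinh s)\<^sup>2"
  have Q: "Q = 1 + 2 * (sinh r)\<^sup>2" unfolding Q_def cosh_square_eq by simp
  have P: "P = Q + (Q + 1) * (sinh s)\<^sup>2" unfolding P_def cosh_square_eq by (simp add: algebra_simps)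
  have Q1: "Q \<ge> 1" unfolding Q by simp
  then have P1: "P \<ge> 1" unfolding P by (smt (verit) mult_nonneg_nonneg zero_le_power2)
  have m0: "m$1 + m$2 + m$3 = 0" using xyz m by simp
  \<comment> \<open>The third exponent is the middle one in both cases. Reversing the order
    exchanges the two vectors together with their weights, so \<open>P\<close> always has the weight
    |x - z| and \<open>Q\<close> the weight |z - y|.\<close>
  have F: "d * d + scal / 2 * (\<bar>x - z\<bar> * ln P + \<bar>z - y\<bar> * ln Q) \<le> d * distX B p q"
    using ord
  proof
    assume o: "y < z \<and> z \<le> x"
    show ?thesis
      using distX_lower[OF basisu_SO3 m0, of 2 1 3 "hyp1 s ** hyp2 r"] o groupF_SL3[OF h] ne
      by (simp add: m fermi_busemann d d_def[symmetric] flip: p_def q_def Q_def P_def) (simp add: algebra_simps)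
  next
    assume o: "x \<le> z \<and> z < y"
    show ?thesis
      using distX_lower[OF basisu_SO3 m0, of 1 2 3 "hyp1 s ** hyp2 r"] o groupF_SL3[OF h] ne
      by (simp add: m fermi_busemann d d_def[symmetric] flip: p_def q_def Q_def P_def)
  qed
  have lnn: "ln P \<ge> 0" "ln Q \<ge> 0" using P1 Q1 by simp_all
  then have "0 \<le> scal / 2 * (\<bar>x - z\<bar> * ln P + \<bar>z - y\<bar> * ln Q)" using scal_pos by simp
  then have "d * d \<le> d * distX B p q" using F by linarith
  then show "distX B p basept \<le> distX B p q" using d(1) unfolding dp by simp
  assume "distX B p q \<le> distX B p basept"
  then have le: "distX B p q \<le> d" by (simp add: dp)
  then have "d * distX B p q \<le> d * d" using d(1) by simp
  then have "scal / 2 * (\<bar>x - z\<bar> * ln P + \<bar>z - y\<bar> * ln Q) \<le> 0" using F by linarith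
  then have "\<bar>x - z\<bar> * ln P + \<bar>z - y\<bar> * ln Q \<le> 0" using scal_pos by (simp add: mult_le_0_iff)
  moreover have "\<bar>x - z\<bar> * ln P \<ge> 0" "\<bar>z - y\<bar> * ln Q \<ge> 0" using lnn by simp_all
  ultimately have e: "\<bar>x - z\<bar> * ln P = 0" "\<bar>z - y\<bar> * ln Q = 0" by linarith+
  have "ln Q = 0" using e(2) ord by auto
  then have "Q = 1" using Q1 by simp
  then have r: "r = 0" by (simp add: Q)
  have "s = 0"
  proof (cases "x = z")
    case False
    then have "P = 1" using e(1) P1 by simp
    then show ?thesis using P \<open>Q = 1\<close> by simp
  next
    case True
    then have y: "y = - 2 * x" using xyz by simp
    have SLm: "exp_diag x y x \<in> SL3" using xyz True by (intro exp_diag_SL3) simp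
    have "p = act (exp_diag x y x) basept"
      unfolding p_def
    proof (rule iffD2[OF coset_eq_iff])
      show "basisu ** exp_diag x y z ** transpose (basisu ** exp_diag x y z)
        = exp_diag x y x ** transpose (exp_diag x y x)"
        by (simp add: basisu_def exp_diag_def diag3_mat9 mat9_simps True)
    qed (use SLm True in \<open>auto intro: SL3_mult SO3_SL3 basisu_SO3\<close>)
    moreover have "exp_diag (-x) (-y) (-x) \<in> SL3" using xyz True by (intro exp_diag_SL3) simp
    ultimately have "distX B p q = distX B basept (act (exp_diag (s - x) (- y) (- s - x)) basept)"
      using distX_translate[of "exp_diag (-x) (-y) (-x)" p q]
      by (simp add: q_def r hyp2_zero hyp1_def act_act exp_diag_mult exp_diag_zero act_one algebra_simps)
    also have "\<dots> = sqrt (scal * ((s - x)\<^sup>2 + y\<^sup>2 + (s + x)\<^sup>2))"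
      by (subst distX_exp_diag) (use y in \<open>auto simp: power2_eq_square algebra_simps\<close>)
    finally have "sqrt (scal * ((s - x)\<^sup>2 + y\<^sup>2 + (s + x)\<^sup>2)) \<le> sqrt (scal * (x\<^sup>2 + y\<^sup>2 + z\<^sup>2))"
      using le by (simp add: d_def)
    then have "(s - x)\<^sup>2 + y\<^sup>2 + (s + x)\<^sup>2 \<le> x\<^sup>2 + y\<^sup>2 + x\<^sup>2" using scal_pos True by simp
    then have "2 * s\<^sup>2 \<le> 0" by (simp add: power2_eq_square algebra_simps)
    then show ?thesis by simp
  qed
  then show "q = basept" by (simp add: q_def r hyp1_zero hyp2_zero act_one)
qed

text \<open>Translation by g carries \<open>nearest_basept\<close> to the point g o. Its second part
  gives the uniqueness that the definite description in \<open>projY\<close> requires.\<close>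

lemma projY_eq:
  assumes g: "g \<in> groupH" and xyz: "x + y + z = 0" and ord: "y < z \<and> z \<le> x \<or> x \<le> z \<and> z < y"
  shows "projY B (act (g ** (basisu ** exp_diag x y z)) basept) = act g basept"
proof -
  define p where "p = act (basisu ** exp_diag x y z) basept"
  have gp: "act (g ** (basisu ** exp_diag x y z)) basept = act g p" by (simp add: p_def act_act)
  have near: "distX B (act g p) (act g basept) \<le> distX B (act g p) y'"
    "distX B (act g p) y' \<le> distX B (act g p) (act g basept) \<Longrightarrow> y' = act g basept"
    if y': "y' \<in> planeY" for y'
  proof -
    have "act (matrix_inv g) y' \<in> planeY" by (intro planeY_act groupH_inv g y')
    then obtain s r where "act (matrix_inv g) y' = act (hyp1 s ** hyp2 r) basept"
      unfolding planeY_eq by blast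
    moreover have "y' = act g (act (matrix_inv g) y')"
      by (simp add: act_act SL3_inv_right groupH_SL3 g act_one)
    ultimately have y'': "y' = act g (act (hyp1 s ** hyp2 r) basept)" by simp
    show "distX B (act g p) (act g basept) \<le> distX B (act g p) y'"
      unfolding y'' distX_translate[OF groupH_SL3[OF g]] p_def by (rule nearest_basept(1)[OF xyz ord])
    show "y' = act g basept" if "distX B (act g p) y' \<le> distX B (act g p) (act g basept)"
      using that nearest_basept(2)[OF xyz ord, of s r]
      unfolding y'' distX_translate[OF groupH_SL3[OF g]] p_def by simp
  qed
  have gY: "act g basept \<in> planeY" using g by (simp add: planeY_def)
  have "(INF y'\<in>planeY. distX B (act g p) y') = distX B (act g p) (act g basept)"
    by (rule cInf_eq_minimum) (use near gY in auto)
  then show ?thesis unfolding projY_def gp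
    by (intro the_equality) (use near gY in auto)
qed

end

section \<open>Floating planes in Fermi coordinates\<close>

lemma tanh_artanh:
  assumes "\<bar>x::real\<bar> < 1" shows "tanh (artanh x) = x"
proof -
  have "1 + x > 0" "1 - x > 0" using assms by auto
  then have e: "exp (- 2 * artanh x) = (1 - x) / (1 + x)"
    by (simp add: artanh_def exp_minus)
  show ?thesis
    unfolding tanh_real_altdef e using \<open>1 + x > 0\<close> by (simp add: field_simps)
qed

text \<open>In the basis \<open>basisu\<close> everything is a 2 by 2 block together with the entry
  exp t. Once the rows of the block are orthogonal, their squared lengths \<open>P\<close> and
  \<open>Q\<close> give the exponents x and y. The order clause says that t is the middle exponent,
  as \<open>nearest_basept\<close> demands.\<close>

lemma floating_fermi:
  fixes t r :: real
  assumes t: "t \<noteq> 0"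
  obtains \<rho> x y where "\<bar>tanh (2 * \<rho>)\<bar> \<le> 1 / cosh (3 * t)" "x + y + t = 0"
    "y < t \<and> t \<le> x \<or> x \<le> t \<and> t < y"
    "act (a_diag t ** hyp2 r) basept = act (hyp2 \<rho> ** (basisu ** exp_diag x y t)) basept"
    "r = 0 \<Longrightarrow> \<rho> = 0"
proof -
  define T where "T = tanh (2 * r) / cosh (3 * t)"
  \<comment> \<open>With this choice of \<open>\<rho>\<close>, the matrix \<open>hyp2 (-\<rho>) ** a_diag t ** hyp2 r\<close> times its transpose is
    diagonal in the basis \<open>basisu\<close>: its off-diagonal entry vanishes iff
    \<open>tanh (2 * \<rho>) = tanh (2 * r) / cosh (3 * t)\<close>.\<close>
  define \<rho> where "\<rho> = artanh T / 2"
  have ch: "cosh (3 * t) \<ge> 1" by (rule cosh_real_ge_1)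
  have th: "\<bar>tanh (2 * r)\<bar> < 1" using tanh_real_bounds[of "2 * r"] by auto
  then have T: "\<bar>T\<bar> < 1" "\<bar>T\<bar> \<le> 1 / cosh (3 * t)"
    using ch by (auto simp: T_def abs_divide divide_le_eq divide_right_mono)
  have \<rho>: "tanh (2 * \<rho>) = T" using T by (simp add: \<rho>_def tanh_artanh)
  define c where "c = cosh \<rho>"
  define s where "s = sinh \<rho>"
  define C where "C = cosh r"
  define S where "S = sinh r"
  define X where "X = exp t"
  define Z where "Z = exp (- 2 * t)"
  have pos: "X > 0" "Z > 0" by (simp_all add: X_def Z_def)
  have cs: "c * c = s * s + 1" "C * C = S * S + 1"
    using cosh_square_eq[of \<rho>] cosh_square_eq[of r] by (simp_all add: c_def s_def C_def S_def power2_eq_square)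
  have XZ: "X * Z = exp (- t)" "X * X * Z = 1" by (simp_all add: X_def Z_def flip: exp_add)
  define \<alpha> where "\<alpha> = c * X * C - s * Z * S"
  define \<beta> where "\<beta> = c * X * S - s * Z * C"
  define \<gamma> where "\<gamma> = c * Z * S - s * X * C"
  define \<delta> where "\<delta> = c * Z * C - s * X * S"
  define n where "n = mat9 \<alpha> \<beta> 0 \<gamma> \<delta> 0 0 0 X"
  have off: "\<alpha> * \<gamma> + \<beta> * \<delta> = 0"
  proof -
    have 2: "cosh (2 * \<rho>) = c * c + s * s" "sinh (2 * \<rho>) = 2 * (s * c)"
      "cosh (2 * r) = C * C + S * S" "sinh (2 * r) = 2 * (S * C)"
      by (simp_all add: cosh_double sinh_double c_def s_def C_def S_def power2_eq_square)
    have Xm: "cosh (3 * t) * (2 * (X * Z)) = X * X + Z * Z"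
    proof -
      have "exp (3 * t) * exp (- t) = X * X" "exp (- (3 * t)) * exp (- t) = Z * Z"
        by (simp_all add: X_def Z_def flip: exp_add)
      then show ?thesis unfolding XZ(1) cosh_def by (simp add: algebra_simps)
    qed
    have cc: "cosh (2 * \<rho>) \<noteq> 0" "cosh (2 * r) \<noteq> 0" "cosh (3 * t) \<noteq> 0" by simp_all
    have "sinh (2 * \<rho>) * (cosh (2 * r) * cosh (3 * t)) = sinh (2 * r) * cosh (2 * \<rho>)"
      using \<rho> cc unfolding T_def tanh_def by (simp add: field_simps)
    then have "sinh (2 * \<rho>) * cosh (2 * r) * (cosh (3 * t) * (2 * (X * Z))) = sinh (2 * r) * cosh (2 * \<rho>) * (2 * (X * Z))"
      by (simp add: mult_ac)
    then have e: "(s * c) * (C * C + S * S) * (X * X + Z * Z) = (S * C) * (c * c + s * s) * (2 * (X * Z))"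
      unfolding Xm unfolding 2 by algebra
    have "\<alpha> * \<gamma> + \<beta> * \<delta> = (S * C) * (c * c + s * s) * (2 * (X * Z)) - (s * c) * (C * C + S * S) * (X * X + Z * Z)"
      unfolding \<alpha>_def \<beta>_def \<gamma>_def \<delta>_def by algebra
    then show ?thesis using e by simp
  qed
  have det: "\<alpha> * \<delta> - \<beta> * \<gamma> = X * Z"
    unfolding \<alpha>_def \<beta>_def \<gamma>_def \<delta>_def using cs by algebra
  define P where "P = \<alpha> * \<alpha> + \<beta> * \<beta>"
  define Q where "Q = \<gamma> * \<gamma> + \<delta> * \<delta>"
  have PQ: "P * Q = (X * X) * (Z * Z)"
    unfolding P_def Q_def using off det by algebra
  have PmQ: "P - Q = (X * X - Z * Z) * (1 + 2 * (S * S))"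
    unfolding P_def Q_def \<alpha>_def \<beta>_def \<gamma>_def \<delta>_def using cs by algebra
  have "P \<ge> 0" "Q \<ge> 0" by (simp_all add: P_def Q_def)
  moreover have "P * Q > 0" using PQ pos by simp
  ultimately have PQ0: "P > 0" "Q > 0" by (auto simp: zero_less_mult_iff)
  define x where "x = ln P / 2"
  define y where "y = ln Q / 2"
  have ex: "exp x * exp x = P" "exp y * exp y = Q"
    using PQ0 by (simp_all add: x_def y_def flip: exp_add)
  have "exp (2 * (x + y)) = (exp x * exp x) * (exp y * exp y)" by (simp flip: exp_add)
  also have "\<dots> = (X * Z) * (X * Z)" unfolding ex PQ by (simp add: mult_ac)
  also have "\<dots> = exp (- 2 * t)" unfolding XZ by (simp flip: exp_add)
  finally have xyt: "x + y + t = 0" by simp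
  have xt: "x \<le> t \<longleftrightarrow> P \<le> X * X" "t \<le> x \<longleftrightarrow> X * X \<le> P"
  proof -
    have "P = exp (2 * x)" "X * X = exp (2 * t)" using ex by (simp_all add: X_def flip: exp_add)
    then show "x \<le> t \<longleftrightarrow> P \<le> X * X" "t \<le> x \<longleftrightarrow> X * X \<le> P" by simp_all
  qed
  have ord: "y < t \<and> t \<le> x \<or> x \<le> t \<and> t < y"
  proof (cases "t > 0")
    case True
    then have "Z < X" by (simp add: X_def Z_def)
    then have "Z * Z < X * X" using pos by (simp add: mult_strict_mono')
    then have "(X * X - Z * Z) * (2 * (S * S)) \<ge> 0" by simp
    then have d: "P - Q \<ge> X * X - Z * Z" unfolding PmQ distrib_left mult_1_right by simp
    \<comment> \<open>Both pairs \<open>P\<close>, \<open>Q\<close> and X^2, Z^2 have the same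
      product, and the difference of the first pair is at least that of the second, so its larger
      member is at least X^2.\<close>
    have "X * X \<le> P"
    proof (rule ccontr)
      assume "\<not> X * X \<le> P"
      then have "Q < Z * Z" "P < X * X" using d by simp_all
      then have "P * Q < (X * X) * (Z * Z)" using PQ0 by (simp add: mult_strict_mono)
      then show False using PQ by simp
    qed
    then show ?thesis using xt xyt True by linarith
  next
    case False
    then have "X < Z" using t by (simp add: X_def Z_def)
    then have "X * X < Z * Z" using pos by (simp add: mult_strict_mono')
    then have "(X * X - Z * Z) * (2 * (S * S)) \<le> 0" by (simp add: mult_nonpos_nonneg)
    then have d: "P - Q \<le> X * X - Z * Z" unfolding PmQ distrib_left mult_1_right by simp
    have "P \<le> X * X"
    proof (rule ccontr)
      assume "\<not> P \<le> X * X"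
      then have "Q > Z * Z" "P > X * X" using d by simp_all
      then have "(X * X) * (Z * Z) < P * Q" by (intro mult_strict_mono') simp_all
      then show False using PQ by simp
    qed
    then show ?thesis using xt xyt False t by linarith
  qed
  have hb: "hyp2 u = basisu ** mat9 (cosh u) (sinh u) 0 (sinh u) (cosh u) 0 0 0 1 ** transpose basisu" for u
    by (simp add: hyp2_def basisu_def mat9_simps)
  have ab: "a_diag t = basisu ** mat9 X 0 0 0 Z 0 0 0 X ** transpose basisu"
    by (simp add: a_diag_def diag3_mat9 basisu_def mat9_simps X_def Z_def)
  have BB: "transpose basisu ** basisu = mat 1" using basisu_SO3 by (simp add: SO3_iff)
  have cancel: "transpose basisu ** (basisu ** M) = M" for M by (simp add: matrix_mul_assoc BB)
  define N where "N = hyp2 (- \<rho>) ** (a_diag t ** hyp2 r)"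
  have N: "N = basisu ** n ** transpose basisu"
  proof -
    have n_eq: "mat9 c (- s) 0 (- s) c 0 0 0 1 ** (mat9 X 0 0 0 Z 0 0 0 X ** mat9 C S 0 S C 0 0 0 1) = n"
      unfolding n_def \<alpha>_def \<beta>_def \<gamma>_def \<delta>_def by (simp add: mat9_simps)
    show ?thesis unfolding N_def hb[of "-\<rho>"] hb[of r] ab n_eq[symmetric]
      by (simp add: cancel c_def s_def C_def S_def flip: matrix_mul_assoc)
  qed
  have nn: "n ** transpose n = exp_diag x y t ** transpose (exp_diag x y t)"
    unfolding n_def exp_diag_def diag3_mat9 mat9_transpose mat9_mult mat9_eq_iff
    using off by (simp add: ex P_def Q_def X_def mult.commute)
  have aS: "a_diag t \<in> SL3" by (simp add: a_diag_def SL3_def diag3_mat9 mat9_simps flip: exp_add)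
  have NS: "N \<in> SL3" unfolding N_def
    by (intro SL3_mult groupF_SL3[OF hyp2_groupF] aS)
  have "act N basept = act (basisu ** exp_diag x y t) basept"
  proof (rule iffD2[OF coset_eq_iff[OF NS]])
    show "basisu ** exp_diag x y t \<in> SL3" by (intro SL3_mult SO3_SL3 basisu_SO3 exp_diag_SL3 xyt)
    have "N ** transpose N = basisu ** (n ** transpose n) ** transpose basisu"
      unfolding N matrix_transpose_mul transpose_transpose
      by (simp add: cancel flip: matrix_mul_assoc)
    also have "\<dots> = basisu ** exp_diag x y t ** transpose (basisu ** exp_diag x y t)"
      unfolding nn matrix_transpose_mul by (simp only: matrix_mul_assoc)
    finally show "N ** transpose N = basisu ** exp_diag x y t ** transpose (basisu ** exp_diag x y t)" .
  qed
  moreover have "a_diag t ** hyp2 r = hyp2 \<rho> ** N"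
  proof -
    have "hyp2 \<rho> ** hyp2 (- \<rho>) = mat 1"
      using SL3_inv_right[OF groupF_SL3[OF hyp2_groupF], of \<rho>] by (simp add: hyp2_inv)
    then show ?thesis by (simp add: N_def matrix_mul_assoc)
  qed
  ultimately have "act (a_diag t ** hyp2 r) basept = act (hyp2 \<rho> ** (basisu ** exp_diag x y t)) basept"
    by (metis act_act)
  moreover have "\<rho> = 0" if "r = 0" using that by (simp add: \<rho>_def T_def artanh_def)
  ultimately show ?thesis using that[of \<rho> x y] T(2) \<rho> xyt ord by simp
qed

section \<open>Complete geodesics in the plane\<close>

text \<open>Multiplied by exp (2 v), the left side is a polynomial of degree at most two in exp (2
  v). The three zeros v0 and v0 \<plusminus> e / 2 therefore force all coefficients to
  vanish.\<close>

lemma exp_combination_unique: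
  fixes a b c e v0 v :: real
  assumes "e > 0" and eq: "\<And>v. v \<in> ball v0 e \<Longrightarrow> a * exp (2 * v) + b + c * exp (- (2 * v)) = 0"
  shows "a * exp (2 * v) + b + c * exp (- (2 * v)) = 0"
proof -
  define Y where "Y = exp e"
  define p where "p = a * exp (2 * v0)"
  define q where "q = c * exp (- (2 * v0))"
  have Y: "Y > 1" using assms(1) by (simp add: Y_def)
  have s: "2 * (v0 + e / 2) = 2 * v0 + e" "2 * (v0 - e / 2) = 2 * v0 - e" by simp_all
  have "exp (2 * (v0 + e / 2)) = exp (2 * v0) * Y" "exp (- (2 * (v0 + e / 2))) = exp (- (2 * v0)) / Y"
    "exp (2 * (v0 - e / 2)) = exp (2 * v0) / Y" "exp (- (2 * (v0 - e / 2))) = exp (- (2 * v0)) * Y"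
    unfolding s Y_def exp_minus exp_add exp_diff by (simp_all add: divide_inverse)
  then have "p * Y + b + q / Y = 0" "p / Y + b + q * Y = 0" "p + b + q = 0"
    using eq[of "v0 + e / 2"] eq[of "v0 - e / 2"] eq[of v0] assms(1)
    by (auto simp: p_def q_def dist_real_def mult.assoc)
  then have 1: "p * Y * Y + b * Y + q = 0" "p + b * Y + q * Y * Y = 0" "p + b + q = 0"
    using Y by (simp_all add: field_simps)
  then have "(p - q) * ((Y - 1) * (Y + 1)) = 0" by algebra
  then have pq: "p = q" using Y by simp
  have "p * ((Y - 1) * (Y - 1)) = 0" using 1 pq by algebra
  then have "p = 0" using Y by simp
  then have "a = 0" "c = 0" "b = 0" using pq 1(3) by (auto simp: p_def q_def)
  then show ?thesis by simp
qed

lemma hyp1_sandwich: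
  "((g ** hyp1 v) ** transpose (g ** hyp1 v)) $ i $ j
     = g$i$1 * g$j$1 * exp (2 * v) + g$i$2 * g$j$2 + g$i$3 * g$j$3 * exp (- (2 * v))"
proof -
  have "(g ** hyp1 v) $ i $ 1 = g$i$1 * exp v" "(g ** hyp1 v) $ i $ 2 = g$i$2" "(g ** hyp1 v) $ i $ 3 = g$i$3 * exp (-v)" for i
    by (simp_all add: matrix_matrix_mult_def sum_3 hyp1_mat9)
  moreover have "exp (2 * v) = exp v * exp v" "exp (- (2 * v)) = exp (- v) * exp (- v)"
    by (simp_all flip: exp_add)
  ultimately show ?thesis
    unfolding matrix_matrix_mult_def[of "g ** hyp1 v" "transpose (g ** hyp1 v)"]
    by (simp add: sum_3 transpose_def mult_ac)
qed

text \<open>In terms of \<open>g ** transpose g\<close>, both curves have entries that are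
  combinations of exp (2 v), 1 and exp (- (2 v)). Agreement near one time thus spreads to all
  times.\<close>

lemma geodesic_unique:
  assumes "g \<in> SL3" "h \<in> SL3" "e > 0" "n > 0"
    and eq: "\<And>r. r \<in> ball t e \<Longrightarrow> act (g ** hyp1 (r / n)) basept = act (h ** hyp1 (r / n)) basept"
  shows "act (g ** hyp1 (r / n)) basept = act (h ** hyp1 (r / n)) basept"
proof -
  have co: "act (g ** hyp1 v) basept = act (h ** hyp1 v) basept \<longleftrightarrow>
      (\<forall>i j. (g$i$1 * g$j$1 - h$i$1 * h$j$1) * exp (2 * v) + (g$i$2 * g$j$2 - h$i$2 * h$j$2)
         + (g$i$3 * g$j$3 - h$i$3 * h$j$3) * exp (- (2 * v)) = 0)" for v
    using assms(1,2)
    by (subst coset_eq_iff) (auto simp: SL3_mult groupF_SL3 hyp1_groupF vec_eq_iff hyp1_sandwich algebra_simps)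
  have "e / n > 0" using assms by simp
  then have "(g$i$1 * g$j$1 - h$i$1 * h$j$1) * exp (2 * w) + (g$i$2 * g$j$2 - h$i$2 * h$j$2)
         + (g$i$3 * g$j$3 - h$i$3 * h$j$3) * exp (- (2 * w)) = 0" for i j and w :: real
  proof (rule exp_combination_unique)
    fix v assume v: "v \<in> ball (t / n) (e / n)"
    have "\<bar>t - v * n\<bar> = \<bar>t / n - v\<bar> * n"
      using assms(4) abs_mult[of "t / n - v" n] by (simp add: left_diff_distrib)
    then have "v * n \<in> ball t e"
      using v assms(4) by (simp add: dist_real_def less_divide_eq)
    from eq[OF this] show "(g$i$1 * g$j$1 - h$i$1 * h$j$1) * exp (2 * v) + (g$i$2 * g$j$2 - h$i$2 * h$j$2)
         + (g$i$3 * g$j$3 - h$i$3 * h$j$3) * exp (- (2 * v)) = 0"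
      using assms(4) unfolding co by simp
  qed
  then show ?thesis unfolding co by blast
qed

lemma A0_eq: "A0 = range hyp1"
  by (simp add: A0_def hyp1_def exp_diag_def)

context invariant_inner
begin

text \<open>Equality in the Lipschitz bound for the Busemann function adapted to the segment forces
  intermediate points onto it.\<close>

lemma between_hyp1:
  assumes y: "y \<in> planeY"
    and "distX B basept y + distX B y (act (hyp1 l) basept) \<le> sqrt (2 * scal) * l" and l: "l > 0"
  shows "y = act (hyp1 (distX B basept y / sqrt (2 * scal))) basept"
proof -
  define n where "n = sqrt (2 * scal)"
  have n: "n > 0" "n * n = 2 * scal" using scal_pos by (simp_all add: n_def)
  obtain g where "g \<in> groupH" "y = act g basept" using y unfolding planeY_def by blast
  then obtain \<theta> \<sigma> where \<sigma>: "\<sigma> \<ge> 0" "y = act (rotu \<theta> ** hyp1 \<sigma>) basept"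
    using polar_coordinates[OF groupH_groupF] by metis
  have d: "distX B basept y = n * \<sigma>"
    using \<sigma> by (simp add: distX_rotu distX_hyp1 n_def)
  define E where "E = exp (2 * \<sigma>)"
  define W where "W = E * ((1 + cos \<theta>) / 2)\<^sup>2 + (sin \<theta>)\<^sup>2 / 2 + ((1 - cos \<theta>) / 2)\<^sup>2 / E"
  have t: "transpose (rotu \<theta> ** hyp1 \<sigma>) = hyp1 \<sigma> ** transpose (rotu \<theta>)"
    by (simp add: matrix_transpose_mul hyp1_transpose)
  have i: "matrix_inv (rotu \<theta> ** hyp1 \<sigma>) = hyp1 (- \<sigma>) ** transpose (rotu \<theta>)"
    by (simp add: SL3_inv_mult groupF_SL3 rotu_groupF hyp1_groupF hyp1_inv SO3_inv rotu_SO3)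
  have x: "transpose (rotu \<theta> ** hyp1 \<sigma>) *v axis 1 1
      = vector [exp \<sigma> * ((1 + cos \<theta>) / 2), - sin \<theta> / sqrt 2, exp (- \<sigma>) * ((1 - cos \<theta>) / 2)]"
    unfolding t vec3_axis by (simp add: rotu_def hyp1_mat9 mat9_transpose mat9_mult mat9_mult_vec)
  have y: "matrix_inv (rotu \<theta> ** hyp1 \<sigma>) *v axis 3 1
      = vector [exp (- \<sigma>) * ((1 - cos \<theta>) / 2), sin \<theta> / sqrt 2, exp \<sigma> * ((1 + cos \<theta>) / 2)]"
    unfolding i vec3_axis by (simp add: rotu_def hyp1_mat9 mat9_transpose mat9_mult mat9_mult_vec)
  have "E = exp \<sigma> * exp \<sigma>" by (simp add: E_def flip: exp_add)
  then have sq: "exp \<sigma> * u * (exp \<sigma> * u) = E * u\<^sup>2" "exp (- \<sigma>) * u * (exp (- \<sigma>) * u) = u\<^sup>2 / E" for u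
    by (simp_all add: power2_eq_square exp_minus divide_inverse mult_ac)
  have "busemann 1 1 (axis 1 1) (axis 3 1) (rotu \<theta> ** hyp1 \<sigma>) = 2 * ln W"
    unfolding busemann_def x y inner_vector3 sq
    by (simp add: W_def power2_eq_square algebra_simps)
  moreover have "busemann 1 1 (mat 1 *v axis 1 1) (mat 1 *v axis 3 1) (mat 1 ** exp_diag l 0 (- l)) = 4 * l"
    using busemann_rotated[OF SO3_one, of "vector [l, 0, -l]" 1 1 1 3] by simp
  then have "busemann 1 1 (axis 1 1) (axis 3 1) (hyp1 l) = 4 * l" by (simp add: hyp1_def)
  moreover have "curves (act (rotu \<theta> ** hyp1 \<sigma>) basept) (act (hyp1 l) basept) \<noteq> {}"
    using curves_nonempty[OF rotu_SO3 SO3_one, of \<sigma> 0 "-\<sigma>" l 0 "-l" \<theta>] by (simp add: hyp1_def)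
  ultimately have "scal / 2 * (4 * l - 2 * ln W) \<le> n * distX B y (act (hyp1 l) basept)"
    using busemann_distX_bound[of "rotu \<theta> ** hyp1 \<sigma>" "hyp1 l" "axis 1 1" "axis 3 1" 1 1]
    by (simp add: \<sigma>(2) n_def SL3_mult groupF_SL3 rotu_groupF hyp1_groupF inner_axis_axis)
  also have "\<dots> \<le> n * (n * l - n * \<sigma>)"
    using assms(2) n(1) d by (intro mult_left_mono) (auto simp: n_def)
  also have "\<dots> = 2 * scal * (l - \<sigma>)" using n(2) by (simp add: algebra_simps)
  finally have "scal * (2 * \<sigma>) \<le> scal * ln W" by (simp add: algebra_simps)
  then have "2 * \<sigma> \<le> ln W" using scal_pos by simp
  have "y = act (hyp1 \<sigma>) basept"
  proof (cases "\<sigma> = 0")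
    case True
    then show ?thesis using \<sigma>(2) by (simp add: hyp1_zero act_SO3 rotu_SO3 act_one)
  next
    case False
    then have E: "E > 1" using \<sigma>(1) by (simp add: E_def)
    have "W > 0"
    proof -
      have "W \<ge> 0" using E by (simp add: W_def)
      \<comment> \<open>For \<open>W = 0\<close> the default value ln 0 = 0 would contradict 2
        \<sigma> > 0.\<close>
      moreover have "W \<noteq> 0" using \<open>2 * \<sigma> \<le> ln W\<close> \<sigma>(1) False by auto
      ultimately show ?thesis by simp
    qed
    then have "E \<le> W" using \<open>2 * \<sigma> \<le> ln W\<close> by (simp add: E_def ln_ge_iff)
    \<comment> \<open>\<open>W\<close> is a mean of E, 1 and 1 / E whose weights sum to 1. Since E >
      1, the inequality E \<le> W leaves weight on E alone, which means that the rotation is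
      trivial.\<close>
    moreover have "E = E * ((1 + cos \<theta>) / 2)\<^sup>2 + E * ((sin \<theta>)\<^sup>2 / 2) + E * ((1 - cos \<theta>) / 2)\<^sup>2"
    proof -
      have "((1 + cos \<theta>) / 2)\<^sup>2 + (sin \<theta>)\<^sup>2 / 2 + ((1 - cos \<theta>) / 2)\<^sup>2 = 1"
        unfolding sin_squared_eq by (simp add: power2_eq_square field_simps)
      then show ?thesis by (metis distrib_left mult.right_neutral)
    qed
    moreover have "(E - 1) * S + (E - 1 / E) * D = E * S - S + (E * D - D / E)" for S D
      by (simp add: left_diff_distrib)
    ultimately have "(E - 1) * ((sin \<theta>)\<^sup>2 / 2) + (E - 1 / E) * ((1 - cos \<theta>) / 2)\<^sup>2 \<le> 0"
      unfolding W_def by smt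
    moreover have "1 / E < 1" using E by simp
    then have "E - 1 \<ge> 0" "E - 1 / E \<ge> 0" using E by linarith+
    then have "(E - 1) * ((sin \<theta>)\<^sup>2 / 2) \<ge> 0" "(E - 1 / E) * ((1 - cos \<theta>) / 2)\<^sup>2 \<ge> 0"
      by (intro mult_nonneg_nonneg; simp)+
    ultimately have "(E - 1) * ((sin \<theta>)\<^sup>2 / 2) = 0" "(E - 1 / E) * ((1 - cos \<theta>) / 2)\<^sup>2 = 0"
      by linarith+
    moreover have "E - 1 / E \<noteq> 0" using E \<open>1 / E < 1\<close> by linarith
    ultimately have "sin \<theta> = 0" "cos \<theta> = 1" using E by simp_all
    then have "rotu \<theta> = mat 1" by (simp add: rotu_def mat9_one)
    then show ?thesis using \<sigma>(2) by simp
  qed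
  then show ?thesis using d n(1) by (simp add: n_def[symmetric])
qed

text \<open>A rotation about the point at time t - e / 2 brings the point at time t + e / 2 onto the
  same translate of A0 o. Distances add up exactly in between, so \<open>between_hyp1\<close> places
  the intermediate points there too. The factor \<open>sqrt (2 * scal)\<close> is the speed of
  \<open>hyp1\<close>.\<close>

lemma geodesic_local:
  assumes Y: "\<And>r. \<gamma> r \<in> planeY"
    and e: "e > 0" "\<And>r s. r \<in> ball t e \<Longrightarrow> s \<in> ball t e \<Longrightarrow> distX B (\<gamma> r) (\<gamma> s) = \<bar>r - s\<bar>"
  obtains h where "h \<in> groupH" "\<And>r. r \<in> ball t (e / 2) \<Longrightarrow> \<gamma> r = act (h ** hyp1 (r / sqrt (2 * scal))) basept"
proof -
  define n where "n = sqrt (2 * scal)"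
  have n: "n > 0" using scal_pos by (simp add: n_def)
  define u where "u = t - e / 2"
  define v where "v = t + e / 2"
  have uv: "u \<in> ball t e" "v \<in> ball t e" using e(1) by (simp_all add: u_def v_def dist_real_def)
  obtain h0 where h0: "h0 \<in> groupH" "\<gamma> u = act h0 basept" using Y unfolding planeY_def by blast
  have "act (matrix_inv h0) (\<gamma> v) \<in> planeY" by (intro planeY_act groupH_inv h0 Y)
  then obtain g where "g \<in> groupH" "act (matrix_inv h0) (\<gamma> v) = act g basept" unfolding planeY_def by blast
  then obtain \<theta> \<sigma> where \<sigma>: "\<sigma> \<ge> 0" "act (matrix_inv h0) (\<gamma> v) = act (rotu \<theta> ** hyp1 \<sigma>) basept"
    using polar_coordinates[OF groupH_groupF] by metis
  define h1 where "h1 = h0 ** rotu \<theta>"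
  have h1: "h1 \<in> groupH" by (simp add: h1_def groupH_mult h0 rotu_groupH)
  have gu: "\<gamma> u = act h1 basept"
    using act_act[of h0 "rotu \<theta>" basept] by (simp add: h1_def h0(2) act_SO3 rotu_SO3)
  have "\<gamma> v = act h0 (act (matrix_inv h0) (\<gamma> v))"
    by (simp add: act_act SL3_inv_right groupH_SL3 h0 act_one)
  then have gv: "\<gamma> v = act h1 (act (hyp1 \<sigma>) basept)"
    by (simp add: \<sigma>(2) h1_def act_act matrix_mul_assoc)
  have "distX B (\<gamma> u) (\<gamma> v) = n * \<sigma>"
    using \<sigma>(1) by (simp add: gu gv distX_translate groupH_SL3 h1 distX_hyp1 n_def)
  then have l: "n * \<sigma> = e" using e(2)[OF uv] e(1) by (simp add: u_def v_def)
  then have \<sigma>0: "\<sigma> > 0" using e(1) n by (metis zero_less_mult_pos)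
  \<comment> \<open>The shift absorbs the starting time u, so that all local pieces are parametrised
    by the same expression in r and can be compared.\<close>
  define h where "h = h1 ** hyp1 (- u / n)"
  have "\<gamma> r = act (h ** hyp1 (r / n)) basept" if r: "r \<in> ball t (e / 2)" for r
  proof -
    have r': "r \<in> ball t e" "u \<le> r" "r \<le> v"
      using r e(1) unfolding u_def v_def mem_ball dist_real_def by linarith+
    define y where "y = act (matrix_inv h1) (\<gamma> r)"
    have y: "y \<in> planeY" unfolding y_def by (intro planeY_act groupH_inv h1 Y)
    have gr: "\<gamma> r = act h1 y" by (simp add: y_def act_act SL3_inv_right groupH_SL3 h1 act_one)
    have dy: "distX B basept y = r - u"
      using e(2)[OF uv(1) r'(1)] r' by (simp add: gu gr distX_translate groupH_SL3 h1)
    moreover have "distX B y (act (hyp1 \<sigma>) basept) = v - r"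
      using e(2)[OF r'(1) uv(2)] r' by (simp add: gv gr distX_translate groupH_SL3 h1)
    ultimately have "y = act (hyp1 ((r - u) / n)) basept"
      using between_hyp1[OF y, of \<sigma>] \<sigma>0 l by (simp add: n_def u_def v_def)
    then show ?thesis
      by (simp add: gr h_def act_act hyp1_add diff_divide_distrib flip: matrix_mul_assoc)
  qed
  moreover have "h \<in> groupH" by (simp add: h_def groupH_mult h1 hyp1_groupH)
  ultimately show ?thesis using that n_def by blast
qed

text \<open>Minimality is only local, so each time t first has its own line. Lines at nearby times
  agree on a small ball, hence everywhere by \<open>geodesic_unique\<close>; the line is a locally
  constant function of t on a connected set.\<close>

lemma complete_geodesic_plane:
  assumes L: "complete_geodesic B L" "L \<subseteq> planeY"
  obtains h where "h \<in> groupH" "L = (\<lambda>b. act (h ** b) basept) ` A0"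
proof -
  define n where "n = sqrt (2 * scal)"
  have n: "n > 0" using scal_pos by (simp add: n_def)
  obtain \<gamma> where \<gamma>: "range \<gamma> = L"
    "\<And>t. \<exists>e>0. \<forall>r\<in>ball t e. \<forall>s\<in>ball t e. distX B (\<gamma> r) (\<gamma> s) = \<bar>r - s\<bar>"
    using L(1) unfolding complete_geodesic_def by blast
  have Y: "\<gamma> r \<in> planeY" for r using \<gamma>(1) L(2) by blast
  define line where "line = (\<lambda>h r. act (h ** hyp1 (r / n)) basept)"
  have "\<exists>h. h \<in> groupH \<and> (\<exists>e>0. \<forall>r\<in>ball t e. \<gamma> r = line h r)" for t
  proof -
    obtain e where e: "e > 0" "\<forall>r\<in>ball t e. \<forall>s\<in>ball t e. distX B (\<gamma> r) (\<gamma> s) = \<bar>r - s\<bar>"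
      using \<gamma>(2) by blast
    obtain h where "h \<in> groupH" "\<And>r. r \<in> ball t (e / 2) \<Longrightarrow> \<gamma> r = line h r"
      using geodesic_local[of \<gamma>, OF Y e(1), of t] e(2) unfolding line_def n_def by blast
    then show ?thesis using e(1) half_gt_zero by blast
  qed
  then obtain h where h: "\<And>t. h t \<in> groupH" "\<And>t. \<exists>e>0. \<forall>r\<in>ball t e. \<gamma> r = line (h t) r"
    by metis
  have loc: "line (h t) = line (h b)" if e: "\<forall>r\<in>ball t e. \<gamma> r = line (h t) r" "b \<in> ball t e" for t b e
  proof -
    obtain e' where e': "e' > 0" "\<forall>r\<in>ball b e'. \<gamma> r = line (h b) r" using h(2) by blast
    have "open (ball t e \<inter> ball b e')" "b \<in> ball t e \<inter> ball b e'" using e(2) e'(1) by auto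
    then obtain d where d: "d > 0" "ball b d \<subseteq> ball t e \<inter> ball b e'"
      using open_contains_ball by blast
    have "line (h t) r = line (h b) r" if "r \<in> ball b d" for r
      using that d(2) e(1) e'(2) by (metis IntE subsetD)
    then show ?thesis unfolding line_def
      using geodesic_unique[OF groupH_SL3[OF h(1)] groupH_SL3[OF h(1)] d(1) n, of b] by blast
  qed
  have const: "line (h t) = line (h 0)" for t
  proof (rule connected_local_const[where A = UNIV and f = "\<lambda>t. line (h t)"])
    show "\<forall>t\<in>UNIV. eventually (\<lambda>b. line (h t) = line (h b)) (at t)"
    proof
      fix t
      obtain e where "e > 0" "\<forall>r\<in>ball t e. \<gamma> r = line (h t) r" using h(2) by blast
      then show "eventually (\<lambda>b. line (h t) = line (h b)) (at t)"
        using loc[of t e] unfolding eventually_at by (metis dist_commute mem_ball)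
    qed
  qed auto
  have "\<gamma> t = line (h 0) t" for t
    using h(2)[of t] const[of t] by (metis centre_in_ball)
  then have "L = range (line (h 0))" using \<gamma>(1) by (metis image_cong)
  also have "\<dots> = (\<lambda>b. act (h 0 ** b) basept) ` A0"
  proof -
    have "range (\<lambda>r. r / n) = UNIV" using n by (intro surjI[of _ "\<lambda>r. r * n"]) simp
    then have A0: "A0 = range (\<lambda>r. hyp1 (r / n))" unfolding A0_eq by (metis image_image)
    show ?thesis unfolding A0 line_def image_image ..
  qed
  finally show ?thesis using that h(1) by blast
qed

section \<open>The limit\<close>

lemma projY_floating:
  assumes h: "h \<in> groupH" and t: "t \<noteq> 0"
  obtains \<rho> where "\<bar>tanh (2 * \<rho>)\<bar> \<le> 1 / cosh (3 * t)" "r = 0 \<Longrightarrow> \<rho> = 0"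
    "projY B (act (h ** a_diag t) (act (hyp1 s ** hyp2 r) basept)) = act (h ** hyp1 s ** hyp2 \<rho>) basept"
proof -
  obtain \<rho> x y where f: "\<bar>tanh (2 * \<rho>)\<bar> \<le> 1 / cosh (3 * t)" "x + y + t = 0"
    "y < t \<and> t \<le> x \<or> x \<le> t \<and> t < y"
    "act (a_diag t ** hyp2 r) basept = act (hyp2 \<rho> ** (basisu ** exp_diag x y t)) basept"
    "r = 0 \<Longrightarrow> \<rho> = 0"
    using floating_fermi[OF t, of r] by blast
  have "a_diag t ** hyp1 s = hyp1 s ** a_diag t"
    by (simp add: a_diag_def hyp1_mat9 diag3_mat9 mat9_simps)
  then have "h ** a_diag t ** (hyp1 s ** hyp2 r) = h ** hyp1 s ** (a_diag t ** hyp2 r)"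
    by (metis matrix_mul_assoc)
  then have "act (h ** a_diag t) (act (hyp1 s ** hyp2 r) basept) = act (h ** hyp1 s) (act (a_diag t ** hyp2 r) basept)"
    by (simp add: act_act)
  also have "\<dots> = act (h ** hyp1 s ** hyp2 \<rho> ** (basisu ** exp_diag x y t)) basept"
    unfolding f(4) by (simp add: act_act matrix_mul_assoc)
  finally have "projY B (act (h ** a_diag t) (act (hyp1 s ** hyp2 r) basept)) = act (h ** hyp1 s ** hyp2 \<rho>) basept"
    using projY_eq[OF _ f(2,3), of "h ** hyp1 s ** hyp2 \<rho>"] h
    by (simp add: groupH_mult hyp1_groupH hyp2_groupH)
  then show ?thesis using that f(1,5) by blast
qed

lemma hausdorff_bound:
  assumes h: "h \<in> groupH" and t: "t \<noteq> 0" and L: "L = (\<lambda>b. act (h ** b) basept) ` A0"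
  shows "hausdorff_distX B (projY B ` act (h ** a_diag t) ` planeY) L
    \<le> ennreal (sqrt (2 * scal) * (artanh (1 / cosh (3 * t)) / 2))"
proof -
  define S where "S = projY B ` act (h ** a_diag t) ` planeY"
  define R where "R = artanh (1 / cosh (3 * t))"
  have "cosh (3 * t) > 1" using t cosh_real_ge_1[of "3 * t"] by (simp add: less_le)
  then have tR: "tanh R = 1 / cosh (3 * t)" unfolding R_def by (intro tanh_artanh) simp
  have A: "(INF y\<in>L. ennreal (distX B x y)) \<le> ennreal (sqrt (2 * scal) * (R / 2))" if xS: "x \<in> S" for x
  proof -
    obtain y where y: "y \<in> planeY" "x = projY B (act (h ** a_diag t) y)"
      using xS by (auto simp: S_def)
    then obtain s r where x: "x = projY B (act (h ** a_diag t) (act (hyp1 s ** hyp2 r) basept))"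
      unfolding planeY_eq by auto
    obtain \<rho> where \<rho>: "\<bar>tanh (2 * \<rho>)\<bar> \<le> 1 / cosh (3 * t)" "x = act (h ** hyp1 s ** hyp2 \<rho>) basept"
      using projY_floating[OF h t, of r s] unfolding x by metis
    \<comment> \<open>tanh is increasing, so 2 |\<rho>| is at most \<open>R\<close>; this is the
      origin of the factor 1 / 2 in the bound.\<close>
    have "tanh \<bar>2 * \<rho>\<bar> \<le> tanh R" using \<rho>(1) unfolding tanh_real_abs tR .
    then have r: "\<bar>\<rho>\<bar> \<le> R / 2" unfolding tanh_real_le_iff by simp
    define y where "y = act (h ** hyp1 s) basept"
    have hs: "h ** hyp1 s ** hyp2 \<rho> \<in> SL3"
      by (intro groupH_SL3 groupH_mult h hyp1_groupH hyp2_groupH)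
    have "hyp2 \<rho> ** hyp2 (- \<rho>) = mat 1"
      using SL3_inv_right[OF groupF_SL3[OF hyp2_groupF], of \<rho>] by (simp add: hyp2_inv)
    then have "y = act (h ** hyp1 s ** hyp2 \<rho>) (act (hyp2 (- \<rho>)) basept)"
      by (simp add: y_def act_act flip: matrix_mul_assoc)
    then have "distX B x y = sqrt (2 * scal) * \<bar>\<rho>\<bar>"
      unfolding \<rho>(2) by (simp add: distX_translate[OF hs] distX_hyp2)
    also have "\<dots> \<le> sqrt (2 * scal) * (R / 2)"
      using r scal_pos by (intro mult_left_mono) auto
    finally have "ennreal (distX B x y) \<le> ennreal (sqrt (2 * scal) * (R / 2))" by (rule ennreal_leI)
    moreover have "y \<in> L" unfolding L A0_eq y_def by blast
    ultimately show ?thesis by (rule INF_lower2[rotated])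
  qed
  have C: "(INF x\<in>S. ennreal (distX B x y)) \<le> ennreal (sqrt (2 * scal) * (R / 2))" if yL: "y \<in> L" for y
  proof -
    obtain s where y: "y = act (h ** hyp1 s) basept" using yL unfolding L A0_eq by blast
    obtain \<rho> where "0 = 0 \<Longrightarrow> \<rho> = 0"
      "projY B (act (h ** a_diag t) (act (hyp1 s ** hyp2 0) basept)) = act (h ** hyp1 s ** hyp2 \<rho>) basept"
      using projY_floating[OF h t, of 0 s] by metis
    then have "y = projY B (act (h ** a_diag t) (act (hyp1 s ** hyp2 0) basept))"
      by (simp add: y hyp2_zero)
    moreover have "act (hyp1 s ** hyp2 0) basept \<in> planeY" unfolding planeY_eq by blast
    ultimately have "y \<in> S" unfolding S_def by blast
    moreover have "distX B y y = 0"
      using distX_hyp1[of 0] h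
      by (simp add: y distX_translate SL3_mult groupH_SL3 hyp1_groupH hyp1_zero act_one)
    ultimately have "(INF x\<in>S. ennreal (distX B x y)) \<le> ennreal 0" by (metis INF_lower)
    then show ?thesis by (simp add: order_trans)
  qed
  show ?thesis unfolding hausdorff_distX_def S_def[symmetric] R_def[symmetric]
    by (intro max.boundedI SUP_least A C)
qed

end

lemma artanh_sech_tendsto: "((\<lambda>t::real. artanh (1 / cosh (3 * t))) \<longlongrightarrow> 0) at_infinity"
proof -
  have "filterlim (\<lambda>t::real. cosh (3 * t)) at_top at_infinity"
  proof (rule filterlim_at_top_mono)
    show "filterlim (norm :: real \<Rightarrow> real) at_top at_infinity" by (rule filterlim_norm_at_top)
    have "norm t \<le> cosh (3 * t)" for t :: real
    proof -
      \<comment> \<open>cosh (3 t) is at least exp |3 t| / 2, hence at least (1 + 3 |t|) / 2, which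
        exceeds |t|.\<close>
      have "exp \<bar>3 * t\<bar> / 2 \<le> cosh \<bar>3 * t\<bar>" unfolding cosh_def by simp
      moreover have "cosh \<bar>3 * t\<bar> = cosh (3 * t)" by (rule cosh_real_abs)
      moreover have "1 + \<bar>3 * t\<bar> \<le> exp \<bar>3 * t\<bar>" by (rule exp_ge_add_one_self)
      ultimately show ?thesis unfolding real_norm_def by linarith
    qed
    then show "eventually (\<lambda>t::real. norm t \<le> cosh (3 * t)) at_infinity" by simp
  qed
  then have "((\<lambda>t::real. 1 / cosh (3 * t)) \<longlongrightarrow> 0) at_infinity"
    by (simp add: tendsto_inverse_0_at_top divide_inverse)
  from tendsto_artanh[OF this] show ?thesis by simp
qed

theorem theorem6p1:
  fixes B :: "real^3^3 \<Rightarrow> real^3^3 \<Rightarrow> real"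
    and L :: "(real^3^3) set set"
  assumes "invariant_metric B"
    and "complete_geodesic B L"
    and "L \<subseteq> planeY"
  shows "((\<lambda>t::real. hausdorff_distX B (projY B ` floating_plane L t) L) \<longlongrightarrow> 0) at_infinity"
proof -
  interpret invariant_inner B by unfold_locales (rule assms(1))
  define h where "h = (SOME h. h \<in> groupH \<and> L = (\<lambda>b. act (h ** b) basept) ` A0)"
  \<comment> \<open>The choice made in \<open>floating_plane\<close> has the required property only
    once some such h is known to exist.\<close>
  have "\<exists>h. h \<in> groupH \<and> L = (\<lambda>b. act (h ** b) basept) ` A0"
    using complete_geodesic_plane[OF assms(2,3)] by blast
  then have "h \<in> groupH \<and> L = (\<lambda>b. act (h ** b) basept) ` A0"
    unfolding h_def by (rule someI_ex)
  then have h: "h \<in> groupH" "L = (\<lambda>b. act (h ** b) basept) ` A0" by blast+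
  have fl: "floating_plane L t = act (h ** a_diag t) ` planeY" for t
    by (simp add: floating_plane_def Let_def h_def)
  have "eventually (\<lambda>t::real. t \<noteq> 0) at_infinity"
    unfolding eventually_at_infinity by (intro exI[of _ 1]) auto
  then have ev: "eventually (\<lambda>t. hausdorff_distX B (projY B ` floating_plane L t) L
      \<le> ennreal (sqrt (2 * scal) * (artanh (1 / cosh (3 * t)) / 2))) at_infinity"
    by eventually_elim (unfold fl, rule hausdorff_bound[OF h(1) _ h(2)])
  have "((\<lambda>t. sqrt (2 * scal) * (artanh (1 / cosh (3 * t)) / 2)) \<longlongrightarrow> sqrt (2 * scal) * (0 / 2)) at_infinity"
    by (intro tendsto_intros artanh_sech_tendsto) simp
  then have "((\<lambda>t. ennreal (sqrt (2 * scal) * (artanh (1 / cosh (3 * t)) / 2))) \<longlongrightarrow> 0) at_infinity"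
    using tendsto_ennrealI by fastforce
  from tendsto_sandwich[OF _ ev tendsto_const this] show ?thesis by simp
qed

end
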